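(* Let $n\ge 2$, $k\ge 1$, $N\geq 1$ be integers and let $h(t)=g(t^2)$, $t\in[-1,1]$, where $g:[0,1]\to(-\infty,\infty]$ is finite and continuous on $[0,1)$, continuous in the extended sense at $1$ (i.e. $\lim_{u\to1^-}g(u)=g(1)$, where $g(1)=+\infty$ is allowed), and $(k+1)$-times differentiable in $(0,1)$. Assume there exists a spherical $(k,k)$-design $C\subset\mathbb S^{n-1}$ of cardinality $N$. Then: (i) If $g^{(k+1)}(u)\ge 0$ on $(0,1)$, then $$m_N^h\ \ge\ m_N^h(k)\ \ge\ m^h(C)\ \ge\ N\sum_{i=1}^{k+1}\rho_i\,h(\alpha_i),$$ where $\alpha_1<\dots<\alpha_{k+1}$ are the zeros of the Gegenbauer polynomial $P_{k+1}^{(n)}$ and $\rho_i$ are the associated weights (defined in the context). Moreover, this bound is the best that can be obtained via polynomials from the set $\mathcal L(k;h)$, and it is provided by the Hermite interpolation polynomial $H_{2k}$: the polynomial $H_{2k}$ belongs to $\mathcal L(k;h)$, it is the unique maximizer of the linear program "maximize $f_0$ subject to $f\in\mathcal L(k;h)$", and $N (H_{2k})_0=N\sum_{i=1}^{k+1}\rho_i h(\alpha_i)$. (ii) If $g^{(k+1)}(u)\le 0$ on $(0,1)$, then $$m_N^h\ \ge\ m_N^h(k)\ \ge\ m^h(C)\ \ge\ N\sum_{i=0}^{k+1}\delta_i\,h(\beta_i),$$ where $\beta_0=-1$, $\beta_{k+1}=1$, $\beta_1<\dots<\beta_k$ are the zeros of the Gegenbauer polynomial $P_k^{(n+2)}$,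 and $\delta_i$ are the associated weights (defined in the context). Moreover, this bound is the best that can be obtained via polynomials from the set $\mathcal L(k;h)$, and it is provided by the Hermite interpolation polynomial $\widetilde H_{2k}$: the polynomial $\widetilde H_{2k}$ belongs to $\mathcal L(k;h)$, it is the unique maximizer of the linear program "maximize $f_0$ subject to $f\in\mathcal L(k;h)$", and $N (\widetilde H_{2k})_0=N\sum_{i=0}^{k+1}\delta_i h(\beta_i)$.
   Context: $\mathbb S^{n-1}$ is the unit sphere in $\mathbb R^n$; a spherical code is a finite nonempty set $C=\{x_1,\dots,x_N\}\subset\mathbb S^{n-1}$, $|C|=N$. Gegenbauer polynomials: $d\mu_n(t)=\gamma_n(1-t^2)^{(n-3)/2}\,dt$ on $[-1,1]$, where $\gamma_n$ is such that $\mu_n$ is a probability measure; $P_\ell^{(n)}$, $\ell\ge0$, are the polynomials with $\deg P_\ell^{(n)}=\ell$, pairwise orthogonal with respect to $\mu_n$, normalized by $P_\ell^{(n)}(1)=1$. A spherical code $C=\{x_1,\dots,x_N\}$ is a spherical $(k,k)$-design if $\sum_{i,j=1}^N P_\ell^{(n)}(x_i\cdot x_j)=0$ for every even $\ell=2,4,\dots,2k$. Potentials: $U^h(x,C)=\sum_{i=1}^N h(x\cdot x_i)$ for $x\in\mathbb S^{n-1}$ (with $t+\infty=\infty$ for $t\in\mathbb R\cup\{+\infty\}$); $m^h(C)=\inf_{x\in\mathbb S^{n-1}}U^h(x,C)$; $m_N^h=\sup\{m^h(C): C\subset\mathbb S^{n-1},\ |C|=N\}$; $m_N^h(k)=\sup\{m^h(C):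 C\subset \mathbb S^{n-1}\text{ is a }(k,k)\text{-design},\ |C|=N\}$. $\Pi_m$ is the space of real univariate polynomials of degree at most $m$. $\mathcal L(k;h)$ is the set of polynomials $f(t)=\sum_{i=0}^k f_{2i}P_{2i}^{(n)}(t)\in\Pi_{2k}$ with $f(t)\le h(t)$ for all $t\in[-1,1]$. For a polynomial $f$, $f_0=\int_{-1}^1 f\,d\mu_n$ denotes the zeroth coefficient of its Gegenbauer expansion. Nodes and weights: the zeros $-1<\alpha_1<\dots<\alpha_{k+1}<1$ of $P^{(n)}_{k+1}$ are real, simple and symmetric about $0$; $\rho_i=\int_{-1}^1L_i\,d\mu_n$, $i=1,\dots,k+1$, where $L_i\in\Pi_k$ are the fundamental Lagrange polynomials for the nodes $\alpha_1,\dots,\alpha_{k+1}$ ($L_i(\alpha_j)=1$ if $i=j$ and $0$ otherwise). The zeros $\beta_1<\dots<\beta_k$ of $P_k^{(n+2)}$ are real, simple, lie in $(-1,1)$ and are symmetric about $0$; $\delta_i=\int_{-1}^1\widetilde L_i\,d\mu_n$, $i=0,\dots,k+1$, where $\widetilde L_i\in\Pi_{k+1}$ are the fundamental Lagrange polynomials for the nodes $\beta_0=-1,\beta_1,\dots,\beta_k,\beta_{k+1}=1$. Interpolation polynomials: $H_{2k}$ is the unique polynomial of degree at most $2k$ such that $H_{2k}(\alpha_i)=h(\alpha_i)$ for $i=1,\dots,k+1$, and $H_{2k}'(\alpha_i)=h'(\alpha_i)$ for every $i$ with $\alpha_i\ne0$. In case (ii), $\widetilde H_{2k}$ is the unique polynomial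 of degree at most $2k$ such that $\widetilde H_{2k}(\beta_i)=h(\beta_i)$ for $i=0,\dots,k+1$, and $\widetilde H_{2k}'(\beta_i)=h'(\beta_i)$ for every $1\le i\le k$ with $\beta_i\ne0$. (In case (ii) the assumptions imply that $g(1)$, hence $h(\pm1)$, is finite.) *)

theory Defs
  imports "HOL-Analysis.Analysis" "HOL-Computational_Algebra.Polynomial"
begin

section \<open>Gegenbauer polynomials\<close>

definition gegenbauer_const :: "nat \<Rightarrow> real" where
  "gegenbauer_const n = 1 / (LBINT t:{-1..1}. (1 - t\<^sup>2) powr ((real n - 3) / 2))"

definition gegenbauer_measure :: "nat \<Rightarrow> real measure" where
  "gegenbauer_measure n = density lborel
     (\<lambda>t. ennreal (gegenbauer_const n * (1 - t\<^sup>2) powr ((real n - 3) / 2) * indicator {-1..1} t))"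

text \<open>The polynomials $P_\ell^{(n)}$; the conditions determine the whole sequence uniquely for
  \<open>n \<ge> 2\<close>.\<close>

definition gegenbauer :: "nat \<Rightarrow> nat \<Rightarrow> real poly" where
  "gegenbauer n = (THE P.
     (\<forall>l. degree (P l) = l) \<and>
     (\<forall>l m. l \<noteq> m \<longrightarrow> (\<integral>t. poly (P l) t * poly (P m) t \<partial>gegenbauer_measure n) = 0) \<and>
     (\<forall>l. poly (P l) 1 = 1))"

text \<open>The coefficient $f_0$ of the Gegenbauer expansion of \<open>f\<close>.\<close>

definition coeff_zero :: "nat \<Rightarrow> real poly \<Rightarrow> real" where
  "coeff_zero n f = (\<integral>t. poly f t \<partial>gegenbauer_measure n)"


section \<open>Spherical codes, designs and potentials\<close>

definition spherical_code :: "(real ^ 'n) set \<Rightarrow> bool" where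
  "spherical_code C \<longleftrightarrow> finite C \<and> C \<noteq> {} \<and> C \<subseteq> sphere 0 1"

definition kk_design :: "nat \<Rightarrow> (real ^ 'n) set \<Rightarrow> bool" where
  "kk_design k C \<longleftrightarrow> spherical_code C \<and>
     (\<forall>l\<in>{1..2 * k}. even l \<longrightarrow> (\<Sum>x\<in>C. \<Sum>y\<in>C. poly (gegenbauer CARD('n) l) (x \<bullet> y)) = 0)"

definition potential :: "(real \<Rightarrow> ereal) \<Rightarrow> real ^ 'n \<Rightarrow> (real ^ 'n) set \<Rightarrow> ereal" where
  "potential h x C = (\<Sum>y\<in>C. h (x \<bullet> y))"

definition min_potential :: "(real \<Rightarrow> ereal) \<Rightarrow> (real ^ 'n) set \<Rightarrow> ereal" where
  "min_potential h C = (INF x\<in>sphere 0 1. potential h x C)"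

text \<open>The quantities $m_N^h$ and $m_N^h(k)$; the type argument fixes the ambient space
  \<open>real ^ 'n\<close>.\<close>

definition maxmin_potential :: "'n::finite itself \<Rightarrow> (real \<Rightarrow> ereal) \<Rightarrow> nat \<Rightarrow> ereal" where
  "maxmin_potential _ h N =
     (SUP C\<in>{C :: (real ^ 'n) set. spherical_code C \<and> card C = N}. min_potential h C)"

definition maxmin_potential_design ::
    "'n::finite itself \<Rightarrow> (real \<Rightarrow> ereal) \<Rightarrow> nat \<Rightarrow> nat \<Rightarrow> ereal" where
  "maxmin_potential_design _ h N k =
     (SUP C\<in>{C :: (real ^ 'n) set. kk_design k C \<and> card C = N}. min_potential h C)"

text \<open>The feasible set $\mathcal L(k;h)$ in dimension \<open>n\<close>.\<close>

definition feasible_polys :: "nat \<Rightarrow> nat \<Rightarrow> (real \<Rightarrow> ereal) \<Rightarrow> real poly set" where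
  "feasible_polys n k h =
     {f. (\<exists>c. f = (\<Sum>i\<le>k. smult (c i) (gegenbauer n (2 * i)))) \<and>
         (\<forall>t\<in>{-1..1}. ereal (poly f t) \<le> h t)}"


section \<open>Nodes and weights\<close>

text \<open>The \<open>i\<close>-th smallest zero of $P_\ell^{(n)}$, counted from \<open>i = 1\<close>.\<close>

definition gegenbauer_zero :: "nat \<Rightarrow> nat \<Rightarrow> nat \<Rightarrow> real" where
  "gegenbauer_zero n l i = sorted_list_of_set {x. poly (gegenbauer n l) x = 0} ! (i - 1)"

definition alpha :: "nat \<Rightarrow> nat \<Rightarrow> nat \<Rightarrow> real" where
  "alpha n k i = gegenbauer_zero n (k + 1) i"

definition beta :: "nat \<Rightarrow> nat \<Rightarrow> nat \<Rightarrow> real" where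
  "beta n k i = (if i = 0 then -1 else if i = k + 1 then 1 else gegenbauer_zero (n + 2) k i)"

definition lagrange_fundamental :: "nat set \<Rightarrow> (nat \<Rightarrow> real) \<Rightarrow> nat \<Rightarrow> real poly" where
  "lagrange_fundamental I x i =
     (THE L. degree L < card I \<and> (\<forall>j\<in>I. poly L (x j) = (if i = j then 1 else 0)))"

definition rho :: "nat \<Rightarrow> nat \<Rightarrow> nat \<Rightarrow> real" where
  "rho n k i = coeff_zero n (lagrange_fundamental {1..k + 1} (alpha n k) i)"

definition delta :: "nat \<Rightarrow> nat \<Rightarrow> nat \<Rightarrow> real" where
  "delta n k i = coeff_zero n (lagrange_fundamental {0..k + 1} (beta n k) i)"


section \<open>Interpolation\<close>

text \<open>The conditions characterizing $H_{2k}$ and $\widetilde H_{2k}$. Values of \<open>h\<close> are compared in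
  \<^typ>\<open>ereal\<close>, so interpolation at a node forces \<open>h\<close> to be finite there.\<close>

definition interpolates_alpha :: "nat \<Rightarrow> nat \<Rightarrow> (real \<Rightarrow> ereal) \<Rightarrow> real poly \<Rightarrow> bool" where
  "interpolates_alpha n k h H \<longleftrightarrow> degree H \<le> 2 * k \<and>
     (\<forall>i\<in>{1..k + 1}. ereal (poly H (alpha n k i)) = h (alpha n k i)) \<and>
     (\<forall>i\<in>{1..k + 1}. alpha n k i \<noteq> 0 \<longrightarrow>
        poly (pderiv H) (alpha n k i) = deriv (\<lambda>t. real_of_ereal (h t)) (alpha n k i))"

definition interpolates_beta :: "nat \<Rightarrow> nat \<Rightarrow> (real \<Rightarrow> ereal) \<Rightarrow> real poly \<Rightarrow> bool" where
  "interpolates_beta n k h H \<longleftrightarrow> degree H \<le> 2 * k \<and>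
     (\<forall>i\<in>{0..k + 1}. ereal (poly H (beta n k i)) = h (beta n k i)) \<and>
     (\<forall>i\<in>{1..k}. beta n k i \<noteq> 0 \<longrightarrow>
        poly (pderiv H) (beta n k i) = deriv (\<lambda>t. real_of_ereal (h t)) (beta n k i))"

end

theory Submission
  imports Defs
begin

text \<open>
  The proof has two independent halves: a design averages every even polynomial of degree at most
  \<open>2 * k\<close> correctly, and the linear program has the Hermite interpolant as its only solution.

  \<^emph>\<open>Averaging.\<close> The design condition involves only the double sums of \<open>P\<^sub>l (u \<bullet> v)\<close> over the code.
  Since \<open>P\<^sub>0, P\<^sub>2, \<dots>, P\<^bsub>2k\<^esub>\<close> span the even polynomials of degree at most \<open>2 * k\<close>, it says that
  the double sum of \<open>(u \<bullet> v) ^ (2 * j)\<close> is \<open>N\<^sup>2\<close> times the moment \<open>c\<close> of order \<open>2 * j\<close>. Regard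
  \<open>(u \<bullet> v) ^ d\<close> as the inner product of the \<open>d\<close>-th tensor powers of \<open>u\<close> and \<open>v\<close>, and let \<open>T\<close> be the sum of
  the tensor powers of the points of the code and \<open>S\<close> the mean tensor power of a rotation invariant
  distribution, scaled so that its inner product with the tensor power of a unit vector is \<open>c\<close>; then
  \<open>S\<close> has squared norm \<open>c\<close> as well, and the squared norm of \<open>T - N S\<close> is
  \<open>N\<^sup>2 c - 2 N\<^sup>2 c + N\<^sup>2 c = 0\<close>. Hence \<open>T = N S\<close>, and pairing with the tensor power of a unit
  vector \<open>x\<close> turns the double sum into the single sum at every \<open>x\<close> (\<open>design_moment\<close>,
  \<open>design_mean\<close>). For the distribution one can
  take a finite product grid with signed weights that has Gaussian moments up to the required order,
  so that all means are finite sums.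

  \<^emph>\<open>Optimality.\<close> Write \<open>f\<^sub>0\<close> by a quadrature rule with positive weights that is exact up to degree
  \<open>2 * k\<close>: Gauss quadrature at the zeros of \<open>P\<^bsub>k+1\<^esub>\<close> if \<open>g\<^bsup>(k+1)\<^esup> \<ge> 0\<close>, Gauss-Lobatto quadrature if
  \<open>g\<^bsup>(k+1)\<^esup> \<le> 0\<close>. Any \<open>f \<le> h\<close> then satisfies \<open>f\<^sub>0 \<le> \<Sum> w\<^sub>i h(x\<^sub>i)\<close>, and equality forces \<open>f\<close> to meet \<open>h\<close>
  at every node and to touch it at the nonzero interior nodes, which determines \<open>f\<close>. What remains is that the
  interpolant lies below \<open>h\<close>. Under \<open>u = t\<^sup>2\<close> it becomes a polynomial of degree at most \<open>k\<close>
  interpolating \<open>g\<close> doubly at the squares in \<open>(0,1)\<close> and simply at those in \<open>{0,1}\<close>. The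
  interpolation error is \<open>g\<^bsup>(k+1)\<^esup>(\<xi>) / (k+1)!\<close> times the monic node polynomial, which on
  \<open>[0,1]\<close> is nonnegative if \<open>1\<close> is not a node and nonpositive if it is
  (\<open>hermite_minorant_exists\<close>). Both cases of the theorem are thus instances of one
  statement about a symmetric node set, \<open>lp_bound\<close>; the only difference is whether \<open>\<plusminus>1\<close> are nodes.
\<close>

section \<open>Interpolation, zero counting and even polynomials\<close>

text \<open>By successively cancelling leading terms.\<close>

lemma graded_basis:
  fixes P :: "nat \<Rightarrow> real poly"
  assumes "\<And>l. l < m \<Longrightarrow> degree (P l) = l \<and> P l \<noteq> 0" and "\<And>i. i \<ge> m \<Longrightarrow> coeff f i = 0"
  shows "\<exists>c. f = (\<Sum>i<m. smult (c i) (P i))"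
  using assms
proof (induction m arbitrary: f)
  case 0
  then show ?case by (auto intro: poly_eqI)
next
  case (Suc m)
  define a where "a = coeff f m / coeff (P m) m"
  have Pm: "degree (P m) = m" "P m \<noteq> 0" using Suc.prems(1)[of m] by auto
  then have "coeff (P m) m \<noteq> 0" using leading_coeff_0_iff[of "P m"] by simp
  have "coeff (f - smult a (P m)) i = 0" if "i \<ge> m" for i
  proof (cases "i = m")
    case True
    then show ?thesis using \<open>coeff (P m) m \<noteq> 0\<close> by (simp add: a_def)
  next
    case False
    then show ?thesis using that Suc.prems(2)[of i] Pm by (simp add: coeff_eq_0)
  qed
  then obtain c where c: "f - smult a (P m) = (\<Sum>i<m. smult (c i) (P i))"
    using Suc.IH[of "f - smult a (P m)"] Suc.prems(1) by auto
  have "f = (\<Sum>i<Suc m. smult ((c(m := a)) i) (P i))"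
    using c by (simp add: algebra_simps)
  then show ?case by blast
qed

lemma lagrange_fundamental_exists:
  assumes "finite I" "inj_on x I" "i \<in> I"
  shows "\<exists>L. degree L < card I \<and> (\<forall>j\<in>I. poly L (x j) = (if i = j then 1 else (0::real)))"
proof -
  define w where "w = (\<Prod>j\<in>I - {i}. [:- x j, 1:])"
  have w0: "poly w (x j) = 0" if "j \<in> I" "j \<noteq> i" for j
    using that assms(1) by (auto simp: w_def poly_prod)
  have wi: "poly w (x i) \<noteq> 0"
    using assms by (auto simp: w_def poly_prod inj_on_def)
  have "degree w = card (I - {i})"
    unfolding w_def by (subst degree_prod_sum_eq) auto
  also have "\<dots> < card I" using assms by (metis card_Diff1_less)
  finally have "degree w < card I" .
  then show ?thesis
    by (intro exI[of _ "smult (1 / poly w (x i)) w"]) (use w0 wi in auto)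
qed

lemma lagrange_fundamental_props:
  assumes "finite I" "inj_on x I" "i \<in> I"
  shows "degree (lagrange_fundamental I x i) < card I"
    and "j \<in> I \<Longrightarrow> poly (lagrange_fundamental I x i) (x j) = (if i = j then 1 else 0)"
proof -
  let ?Q = "\<lambda>L. degree L < card I \<and> (\<forall>j\<in>I. poly L (x j) = (if i = j then 1 else (0::real)))"
  have "\<exists>!L. ?Q L"
  proof (rule ex_ex1I)
    show "\<exists>L. ?Q L" by (rule lagrange_fundamental_exists[OF assms])
  next
    fix L M assume "?Q L" "?Q M"
    then show "L = M"
      by (intro poly_eqI_degree[of "x ` I"]) (auto simp: card_image[OF assms(2)])
  qed
  then have "?Q (lagrange_fundamental I x i)"
    unfolding lagrange_fundamental_def by (rule theI')
  then show "degree (lagrange_fundamental I x i) < card I"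
    "j \<in> I \<Longrightarrow> poly (lagrange_fundamental I x i) (x j) = (if i = j then 1 else 0)" by auto
qed

lemma lagrange_interpolation:
  assumes "finite I" "inj_on x I" "degree p < card I"
  shows "p = (\<Sum>i\<in>I. smult (poly p (x i)) (lagrange_fundamental I x i))" (is "p = ?S")
proof (rule poly_eqI_degree[of "x ` I"])
  fix y assume "y \<in> x ` I"
  then obtain j where j: "j \<in> I" "y = x j" by auto
  have "poly ?S y = (\<Sum>i\<in>I. if i = j then poly p (x i) else 0)"
    unfolding poly_sum poly_smult
    by (intro sum.cong refl) (use assms j in \<open>simp add: lagrange_fundamental_props\<close>)
  then show "poly p y = poly ?S y" using j assms(1) by simp
next
  have "degree ?S < card I"
    using assms lagrange_fundamental_props(1)[OF assms(1,2)]
    by (intro degree_sum_less) (auto intro: le_less_trans[OF degree_smult_le])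
  then show "card (x ` I) > degree ?S" by (simp add: card_image[OF assms(2)])
qed (use assms in \<open>simp add: card_image\<close>)

lemma interpolating_poly_exists:
  fixes v :: "real \<Rightarrow> real"
  assumes "finite U"
  shows "\<exists>G. (\<forall>u\<in>U. poly G u = v u) \<and> (\<forall>i\<ge>card U. coeff G i = 0)"
proof -
  have "\<forall>u\<in>U. \<exists>L. degree L < card U \<and> (\<forall>j\<in>U. poly L j = (if u = j then 1 else (0::real)))"
    using lagrange_fundamental_exists[OF assms, of "\<lambda>u. u"] by simp
  then obtain L where L: "\<And>u. u \<in> U \<Longrightarrow> degree (L u) < card U"
      "\<And>u j. u \<in> U \<Longrightarrow> j \<in> U \<Longrightarrow> poly (L u) j = (if u = j then 1 else (0::real))"
    by metis
  define G where "G = (\<Sum>i\<in>U. smult (v i) (L i))"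
  have "poly G u = v u" if "u \<in> U" for u
  proof -
    have "poly G u = (\<Sum>i\<in>U. if i = u then v i else 0)"
      unfolding G_def poly_sum poly_smult by (intro sum.cong refl) (use L(2) that in simp)
    then show ?thesis using assms that by simp
  qed
  moreover have "coeff G i = 0" if "i \<ge> card U" for i
    unfolding G_def coeff_sum by (intro sum.neutral ballI) (use L(1) that in \<open>force intro: coeff_eq_0\<close>)
  ultimately show ?thesis by blast
qed

text \<open>Zeros are counted with multiplicity, but only up to multiplicity two. The proof divides out the
  linear factors of one node at a time; the derivative of the quotient still vanishes at the
  remaining double zeros.\<close>

lemma hermite_zero_count:
  fixes p :: "real poly"
  assumes "p \<noteq> 0" "finite X" "Y \<subseteq> X"
    and "\<forall>x\<in>X. poly p x = 0" "\<forall>x\<in>Y. poly (pderiv p) x = 0"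
  shows "card X + card Y \<le> degree p"
  using assms(2-5) \<open>p \<noteq> 0\<close>
proof (induction X arbitrary: p Y rule: finite_induct)
  case empty
  then show ?case by simp
next
  case (insert a X)
  then obtain q where q: "p = [:-a, 1:] * q"
    by (auto simp: poly_eq_0_iff_dvd dvd_def)
  then have "q \<noteq> 0" using insert.prems by auto
  have dp: "poly (pderiv p) x = poly q x + (x - a) * poly (pderiv q) x" for x
    by (simp only: q pderiv_mult poly_add poly_mult) (simp add: pderiv_pCons algebra_simps)
  have degp: "degree p = Suc (degree q)" using \<open>q \<noteq> 0\<close> by (simp add: q degree_mult_eq del: mult_pCons_left)
  have qX: "poly q x = 0" if "x \<in> X" for x
    using insert.prems(2) insert.hyps that by (auto simp: q)
  have qY: "poly (pderiv q) x = 0" if "x \<in> Y - {a}" for x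
  proof -
    have "x \<in> X" "x \<noteq> a" "poly (pderiv p) x = 0" using that insert by auto
    then show ?thesis using dp[of x] qX[of x] by simp
  qed
  have fY: "finite Y" using insert.prems(1) insert.hyps finite_subset by auto
  show ?case
  proof (cases "a \<in> Y")
    case False
    then show ?thesis
      using insert.IH[of Y q] insert.prems(1) insert.hyps qX qY \<open>q \<noteq> 0\<close> degp
      by (simp add: subset_insert)
  next
    case True
    then have "poly q a = 0" using dp[of a] insert.prems by simp
    then obtain r where r: "q = [:-a, 1:] * r" by (auto simp: poly_eq_0_iff_dvd dvd_def)
    then have "r \<noteq> 0" using \<open>q \<noteq> 0\<close> by auto
    have degq: "degree q = Suc (degree r)" using \<open>r \<noteq> 0\<close> by (simp add: r degree_mult_eq del: mult_pCons_left)
    have dq: "poly (pderiv q) x = poly r x + (x - a) * poly (pderiv r) x" for x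
      by (simp only: r pderiv_mult poly_add poly_mult) (simp add: pderiv_pCons algebra_simps)
    have rX: "poly r x = 0" if "x \<in> X" for x
      using qX[OF that] insert.hyps that by (auto simp: r)
    have rY: "poly (pderiv r) x = 0" if "x \<in> Y - {a}" for x
    proof -
      have "x \<in> X" "x \<noteq> a" using that insert by auto
      then show ?thesis using dq[of x] rX[of x] qY[OF that] by simp
    qed
    have "card Y = Suc (card (Y - {a}))" by (rule card.remove[OF fY True])
    moreover have "card X + card (Y - {a}) \<le> degree r"
    proof (rule insert.IH)
      show "Y - {a} \<subseteq> X" using insert.prems(1) by blast
      show "\<forall>x\<in>X. poly r x = 0" using rX by blast
      show "\<forall>x\<in>Y - {a}. poly (pderiv r) x = 0" using rY by blast
    qed (rule \<open>r \<noteq> 0\<close>)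
    ultimately show ?thesis unfolding degp degq using insert.hyps by simp
  qed
qed

text \<open>Evenness is phrased through \<open>pcompose\<close> because the Gegenbauer polynomials are reflected in this
  form; \<open>even_poly_coeff\<close> translates it to coefficients.\<close>

definition even_poly :: "real poly \<Rightarrow> bool" where
  "even_poly p \<longleftrightarrow> pcompose p [:0, -1:] = p"

lemma coeff_reflect: "coeff (pcompose p [:0, -1:]) i = (-1) ^ i * coeff (p :: real poly) i"
  by (simp add: coeff_pcompose_linear)

lemma even_poly_coeff: "even_poly p \<longleftrightarrow> (\<forall>i. odd i \<longrightarrow> coeff p i = 0)"
  unfolding even_poly_def poly_eq_iff coeff_reflect by (auto simp: minus_one_power_iff)

lemma even_poly_diff: "even_poly p \<Longrightarrow> even_poly q \<Longrightarrow> even_poly (p - q)"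
  and even_poly_smult: "even_poly p \<Longrightarrow> even_poly (smult c p)"
  and even_poly_monom: "even i \<Longrightarrow> even_poly (monom 1 i)"
  by (auto simp: even_poly_coeff coeff_monom)

lemma even_poly_square_arg: "even_poly (pcompose G [:0, 0, 1:])"
proof -
  have "pcompose [:0, 0, 1:] [:0, -1:] = [:0, 0, 1::real:]" by (simp add: pcompose_pCons)
  then show ?thesis by (simp add: even_poly_def pcompose_assoc[symmetric])
qed

text \<open>Even polynomials can be expanded using only the even members of a graded family: after the
  leading term is cancelled, evenness makes the next coefficient vanish as well, so that the degree
  drops by two.\<close>

lemma even_poly_span:
  fixes P :: "nat \<Rightarrow> real poly"
  assumes "\<And>l. l < m \<Longrightarrow> degree (P l) = 2 * l \<and> P l \<noteq> 0 \<and> even_poly (P l)"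
    and "even_poly f" "\<And>i. i \<ge> 2 * m - 1 \<Longrightarrow> coeff f i = 0" "m > 0 \<or> f = 0"
  shows "\<exists>c. f = (\<Sum>i<m. smult (c i) (P i))"
  using assms
proof (induction m arbitrary: f)
  case 0
  then show ?case by (auto intro: poly_eqI)
next
  case (Suc m)
  define a where "a = coeff f (2*m) / coeff (P m) (2*m)"
  have Pm: "degree (P m) = 2*m" "P m \<noteq> 0" "even_poly (P m)" using Suc.prems(1)[of m] by auto
  then have Pm0: "coeff (P m) (2*m) \<noteq> 0" using leading_coeff_0_iff[of "P m"] by simp
  have ev: "even_poly (f - smult a (P m))"
    using Pm Suc.prems by (intro even_poly_diff even_poly_smult)
  have *: "coeff (f - smult a (P m)) i = 0" if "i \<ge> 2*m - 1" for i
  proof (cases "i = 2*m")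
    case True
    then show ?thesis using Pm0 by (simp add: a_def)
  next
    case False
    show ?thesis
    proof (cases "i < 2*m")
      case True
      then have "odd i" using that by presburger
      then show ?thesis using ev by (simp add: even_poly_coeff)
    next
      case False
      with \<open>i \<noteq> 2*m\<close> show ?thesis using Suc.prems(3)[of i] Pm by (simp add: coeff_eq_0)
    qed
  qed
  have "m > 0 \<or> f - smult a (P m) = 0"
    using * by (cases m) (auto intro: poly_eqI)
  then obtain c where c: "f - smult a (P m) = (\<Sum>i<m. smult (c i) (P i))"
    using Suc.IH[of "f - smult a (P m)"] Suc.prems(1) ev * by auto
  have "f = (\<Sum>i<Suc m. smult ((c(m := a)) i) (P i))"
    using c by (simp add: algebra_simps)
  then show ?case by blast
qed

text \<open>A sign change in the interval needs a zero of odd order there. The zeros of even order are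
  divided out in pairs, until the intermediate value theorem applies to a polynomial without zeros in
  the open interval.\<close>

lemma even_order_imp_constant_sign:
  fixes f :: "real poly"
  assumes "f \<noteq> 0" "\<forall>r\<in>{-1<..<1}. even (order r f)"
  shows "(\<forall>t\<in>{-1..1}. 0 \<le> poly f t) \<or> (\<forall>t\<in>{-1..1}. poly f t \<le> 0)"
  using assms
proof (induction "degree f" arbitrary: f rule: less_induct)
  case less
  show ?case
  proof (cases "\<exists>r\<in>{-1<..<1}. poly f r = 0")
    case True
    then obtain r where r: "r \<in> {-1<..<1}" "poly f r = 0" by auto
    then have "order r f \<noteq> 0" using less.prems order_root by blast
    then have "order r f \<ge> 2" using less.prems(2) r
      by (metis One_nat_def even_Suc even_zero less_2_cases_iff not_le)
    then have "[:-r, 1:]^2 dvd f" by (simp add: order_divides)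
    then obtain q where q: "f = [:-r, 1:]^2 * q" by (auto simp: dvd_def)
    have "q \<noteq> 0" using q less.prems by auto
    have "degree f = degree q + 2"
      unfolding q using \<open>q \<noteq> 0\<close> by (subst degree_mult_eq) (auto simp: degree_linear_power)
    moreover have "even (order s q)" if "s \<in> {-1<..<1}" for s
    proof -
      have "order s f = order s ([:-r, 1:]^2) + order s q"
        using q less.prems(1) order_mult by metis
      moreover have "even (order s ([:-r, 1:]^2))"
        by (cases "s = r") (auto simp: order_power_n_n order_0I)
      ultimately show ?thesis using less.prems(2) that by (metis even_add)
    qed
    ultimately have "(\<forall>t\<in>{-1..1}. 0 \<le> poly q t) \<or> (\<forall>t\<in>{-1..1}. poly q t \<le> 0)"
      using less.hyps[of q] \<open>q \<noteq> 0\<close> by auto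
    moreover have "poly f t = (t - r)^2 * poly q t" for t
      by (simp add: q poly_power)
    ultimately show ?thesis
      by (auto simp: zero_le_mult_iff mult_le_0_iff)
  next
    case False
    show ?thesis
    proof (rule ccontr)
      assume "\<not> ?thesis"
      then obtain s t where st: "s \<in> {-1..1}" "t \<in> {-1..1}" "poly f s < 0" "poly f t > 0"
        by (meson not_le)
      then have "s \<noteq> t" by auto
      then consider "s < t" | "t < s" by linarith
      then show False
      proof cases
        case 1
        then obtain x where "s < x" "x < t" "poly f x = 0" using poly_IVT_pos[of s t f] st by auto
        then show ?thesis using False st by auto
      next
        case 2
        then obtain x where "t < x" "x < s" "poly f x = 0" using poly_IVT_neg[of t s f] st by auto
        then show ?thesis using False st by auto
      qed
    qed
  qed
qed

section \<open>Orthogonal polynomials and quadrature for positive functionals\<close>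

text \<open>The zeros of orthogonal polynomials and the quadrature rules at them depend only on linearity and
  on positivity on \<open>[-1, 1]\<close>. The locale is instantiated with the Gegenbauer functionals of the two
  dimensions \<open>n\<close> and \<open>n + 2\<close>.\<close>

locale positive_functional =
  fixes L :: "real poly \<Rightarrow> real"
  assumes L_add: "L (p + q) = L p + L q"
    and L_smult: "L (smult c p) = c * L p"
    and L_pos: "p \<noteq> 0 \<Longrightarrow> (\<And>t. t \<in> {-1..1} \<Longrightarrow> 0 \<le> poly p t) \<Longrightarrow> 0 < L p"
begin

lemma L_0 [simp]: "L 0 = 0"
  using L_smult[of 0 0] by simp

lemma L_diff: "L (p - q) = L p - L q"
  using L_add[of p "smult (-1) q"] L_smult[of "-1" q] by simp

lemma L_sum: "L (\<Sum>i\<in>A. f i) = (\<Sum>i\<in>A. L (f i))"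
  by (induction A rule: infinite_finite_induct) (auto simp: L_add)

lemma L_square_pos: "p \<noteq> 0 \<Longrightarrow> 0 < L (p * p)"
  by (rule L_pos) auto

definition orthogonal :: "real poly \<Rightarrow> bool" where
  "orthogonal p \<longleftrightarrow> (\<forall>q. degree q < degree p \<longrightarrow> L (p * q) = 0)"

text \<open>The Gram-Schmidt process applied to the monomials.\<close>

lemma orthogonal_exists: "\<exists>p. degree p = l \<and> p \<noteq> 0 \<and> orthogonal p"
proof (induction l rule: less_induct)
  case (less l)
  then have "\<forall>j. \<exists>p. j < l \<longrightarrow> degree p = j \<and> p \<noteq> 0 \<and> orthogonal p" by blast
  then obtain P where P: "\<And>j. j < l \<Longrightarrow> degree (P j) = j \<and> P j \<noteq> 0 \<and> orthogonal (P j)" by metis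
  \<comment> \<open>the projection of the monomial to the lower degrees\<close>
  define s where "s = (\<Sum>j<l. smult (L (monom 1 l * P j) / L (P j * P j)) (P j))"
  define p where "p = monom 1 l - s"
  have cs: "coeff s i = 0" if "i \<ge> l" for i
    unfolding s_def coeff_sum by (intro sum.neutral ballI) (use P that in \<open>force intro: coeff_eq_0\<close>)
  have "coeff p l = 1" using cs[of l] by (simp add: p_def)
  moreover have "coeff p i = 0" if "i > l" for i using cs[of i] that by (simp add: p_def)
  ultimately have deg: "degree p = l"
    by (metis le_degree degree_le le_antisym zero_neq_one)
  have "p \<noteq> 0" using \<open>coeff p l = 1\<close> by auto
  have PP: "L (P i * P j) = 0" if "i < l" "j < l" "i \<noteq> j" for i j
  proof (cases "i < j")
    case True
    then show ?thesis using P[of i] P[of j] that by (simp add: orthogonal_def mult.commute[of "P i"])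
  next
    case False
    then show ?thesis using P[of i] P[of j] that by (simp add: orthogonal_def)
  qed
  have pP: "L (p * P j) = 0" if "j < l" for j
  proof -
    have "L (s * P j) = (\<Sum>i<l. L (monom 1 l * P i) / L (P i * P i) * L (P i * P j))"
      by (simp add: s_def sum_distrib_right L_sum L_smult)
    also have "\<dots> = (\<Sum>i<l. if i = j then L (monom 1 l * P j) else 0)"
      using L_square_pos[of "P j"] P[OF that] that by (intro sum.cong refl) (auto simp: PP)
    also have "\<dots> = L (monom 1 l * P j)" using that by simp
    finally show ?thesis by (simp add: p_def left_diff_distrib L_diff)
  qed
  have "orthogonal p"
    unfolding orthogonal_def deg
  proof (intro allI impI)
    fix q :: "real poly" assume "degree q < l"
    then obtain c where "q = (\<Sum>i<l. smult (c i) (P i))"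
      using graded_basis[of l P q] P by (auto simp: coeff_eq_0)
    then show "L (p * q) = 0" by (simp add: sum_distrib_left L_sum L_smult pP)
  qed
  with deg \<open>p \<noteq> 0\<close> show ?case by blast
qed

text \<open>Cancelling the leading terms leaves a combination of smaller degree that is orthogonal to
  itself. Comparing leading coefficients crosswise avoids choosing a normalization.\<close>

lemma orthogonal_unique:
  assumes "orthogonal p" "orthogonal q" "degree p = degree q" "p \<noteq> 0"
  shows "smult (lead_coeff q) p = smult (lead_coeff p) q"
proof (rule ccontr)
  define d where "d = smult (lead_coeff q) p - smult (lead_coeff p) q"
  assume "\<not> ?thesis"
  then have "d \<noteq> 0" by (simp add: d_def)
  have "degree d < degree p"
  proof (rule ccontr)
    assume "\<not> ?thesis"
    moreover have "degree d \<le> degree p" unfolding d_def using assms(3)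
      by (intro degree_diff_le order_trans[OF degree_smult_le]) auto
    ultimately have "degree d = degree p" by simp
    then have "lead_coeff d = 0" using assms(3) by (simp add: d_def)
    with \<open>d \<noteq> 0\<close> show False by simp
  qed
  then have "L (p * d) = 0" "L (q * d) = 0" using assms by (auto simp: orthogonal_def)
  moreover have "d * d = smult (lead_coeff q) (p * d) - smult (lead_coeff p) (q * d)"
    unfolding mult_smult_left[symmetric] left_diff_distrib[symmetric] by (simp add: d_def)
  ultimately have "L (d * d) = 0" by (simp add: L_diff L_smult)
  with L_square_pos[OF \<open>d \<noteq> 0\<close>] show False by simp
qed

text \<open>With fewer than \<open>degree p\<close> sign changes in \<open>(-1, 1)\<close>, the polynomial \<open>q\<close> with simple zeros exactly at
  the sign changes would be orthogonal to \<open>p\<close>, although \<open>p * q\<close> has constant sign.\<close>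

lemma orthogonal_zeros:
  assumes "orthogonal p" "p \<noteq> 0"
  shows "card {x. poly p x = 0} = degree p" "{x. poly p x = 0} \<subseteq> {-1<..<1}"
proof -
  let ?Z = "{x. poly p x = 0}"
  \<comment> \<open>the points at which \<open>p\<close> changes sign\<close>
  define S where "S = {r \<in> {-1<..<1}. odd (order r p)}"
  have S: "S \<subseteq> ?Z" "S \<subseteq> {-1<..<1}"
    by (auto simp: S_def) (metis assms(2) even_zero order_root)
  have fin: "finite ?Z" using assms(2) poly_roots_finite by blast
  then have "finite S" using S finite_subset by blast
  define q where "q = (\<Prod>r\<in>S. [:-r, 1:])"
  have "q \<noteq> 0" using \<open>finite S\<close> by (simp add: q_def)
  have degq: "degree q = card S"
    unfolding q_def by (subst degree_prod_sum_eq) auto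
  have ordq: "order r q = (if r \<in> S then 1 else 0)" for r
  proof -
    have "order r (\<Prod>s\<in>A. [:-s, 1:]) = (if r \<in> A then 1 else 0)" if "finite A" for A :: "real set"
      using that
    proof (induction A rule: finite_induct)
      case (insert a A)
      have "order r [:-a, 1:] = (if r = a then 1 else 0)"
        using order_power_n_n[of a 1] by (auto intro: order_0I)
      then show ?case using insert by (auto simp: order_mult simp del: mult_pCons_left)
    qed (auto intro: order_0I)
    then show ?thesis using \<open>finite S\<close> by (simp add: q_def)
  qed
  have "p * q \<noteq> 0" using assms \<open>q \<noteq> 0\<close> by simp
  moreover have "\<forall>r\<in>{-1<..<1}. even (order r (p * q))"
    using \<open>p * q \<noteq> 0\<close> by (auto simp: order_mult ordq S_def)
  ultimately have "(\<forall>t\<in>{-1..1}. 0 \<le> poly (p * q) t) \<or> (\<forall>t\<in>{-1..1}. poly (p * q) t \<le> 0)"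
    by (rule even_order_imp_constant_sign)
  then have "L (p * q) \<noteq> 0"
  proof
    assume "\<forall>t\<in>{-1..1}. 0 \<le> poly (p * q) t"
    then show ?thesis using L_pos[of "p * q"] \<open>p * q \<noteq> 0\<close> by force
  next
    assume "\<forall>t\<in>{-1..1}. poly (p * q) t \<le> 0"
    then have "0 < L (smult (-1) (p * q))" using \<open>p * q \<noteq> 0\<close> by (intro L_pos) auto
    then show ?thesis by (simp only: L_smult)
  qed
  then have "degree p \<le> card S" using assms(1) degq by (force simp: orthogonal_def)
  moreover have "card S \<le> card ?Z" using S fin card_mono by blast
  moreover have "card ?Z \<le> degree p" using assms(2) by (rule card_poly_roots_bound)
  ultimately have "card S = card ?Z" "card ?Z = degree p" by auto
  then show "card ?Z = degree p" "?Z \<subseteq> {-1<..<1}"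
    using S card_subset_eq[OF fin S(1)] by auto
qed

text \<open>Divide by the node polynomial: the multiple of it is annihilated, and the remainder is
  reproduced by Lagrange interpolation. This covers both Gauss and Gauss-Lobatto rules, which differ
  in how many powers the node polynomial is orthogonal to.\<close>

lemma quadrature_exact:
  assumes I: "finite I" "inj_on x I"
    and orth: "\<And>q. degree q + card I \<le> M \<Longrightarrow> L ((\<Prod>i\<in>I. [:- x i, 1:]) * q) = 0"
    and "degree p \<le> M" "I \<noteq> {}"
  shows "L p = (\<Sum>i\<in>I. L (lagrange_fundamental I x i) * poly p (x i))"
proof -
  define w where "w = (\<Prod>i\<in>I. [:- x i, 1:])"
  define q where "q = p div w"
  define r where "r = p mod w"
  have "w \<noteq> 0" using I by (simp add: w_def)
  have degw: "degree w = card I" unfolding w_def by (subst degree_prod_sum_eq) auto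
  have p: "p = w * q + r" by (simp add: q_def r_def)
  have "degree r < card I"
    using degree_mod_less'[of w p] degw \<open>w \<noteq> 0\<close> \<open>I \<noteq> {}\<close> I
    by (cases "r = 0") (auto simp: r_def card_gt_0_iff)
  have "L (w * q) = 0"
  proof (cases "q = 0")
    case False
    then have "degree (w * q) = card I + degree q" using \<open>w \<noteq> 0\<close> by (simp add: degree_mult_eq degw)
    then have "degree p = card I + degree q"
      using p \<open>degree r < card I\<close> by (metis degree_add_eq_left trans_less_add1)
    then show ?thesis using assms(4) orth[of q] by (simp add: w_def)
  qed simp
  have px: "poly p (x i) = poly r (x i)" if "i \<in> I" for i
    using that I by (auto simp: p w_def poly_prod)
  have "L p = L r" using p \<open>L (w * q) = 0\<close> by (metis L_add add_0)
  also have "\<dots> = L (\<Sum>i\<in>I. smult (poly r (x i)) (lagrange_fundamental I x i))"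
    using lagrange_interpolation[OF I \<open>degree r < card I\<close>] by simp
  also have "\<dots> = (\<Sum>i\<in>I. L (lagrange_fundamental I x i) * poly p (x i))"
    by (simp add: L_sum L_smult px mult.commute cong: sum.cong)
  finally show ?thesis .
qed

text \<open>A weight is positive as soon as some nonnegative polynomial of admissible degree isolates its
  node.\<close>

lemma quadrature_weight_pos:
  assumes "finite I" "i \<in> I"
    and exact: "\<And>p. degree p \<le> M \<Longrightarrow> L p = (\<Sum>i\<in>I. w i * poly p (x i))"
    and p: "degree p \<le> M" "\<And>t. t \<in> {-1..1} \<Longrightarrow> 0 \<le> poly p t"
       "\<And>j. j \<in> I \<Longrightarrow> j \<noteq> i \<Longrightarrow> poly p (x j) = 0" "0 < poly p (x i)"
  shows "0 < w i"
proof -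
  have "0 < L p" using p by (intro L_pos) auto
  also have "L p = (\<Sum>j\<in>I. if j = i then w i * poly p (x i) else 0)"
    unfolding exact[OF p(1)] by (intro sum.cong refl) (auto simp: p(3))
  also have "\<dots> = w i * poly p (x i)" using assms(1,2) by simp
  finally show ?thesis using p(4) by (simp add: zero_less_mult_iff)
qed

end

lemma sorted_list_nth_bij_betw:
  assumes "finite (A :: real set)"
  shows "bij_betw (\<lambda>i. sorted_list_of_set A ! (i - 1)) {1..card A} A"
proof -
  have "bij_betw (\<lambda>i. i - 1) {1..card A} {..<card A}"
    by (rule bij_betwI[of _ _ _ Suc]) auto
  moreover have "bij_betw ((!) (sorted_list_of_set A)) {..<card A} A"
    using assms by (intro bij_betw_nth) auto
  ultimately have "bij_betw ((!) (sorted_list_of_set A) \<circ> (\<lambda>i. i - 1)) {1..card A} A"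
    by (rule bij_betw_trans)
  then show ?thesis by (simp add: o_def)
qed

section \<open>The Gegenbauer functional\<close>

definition gegenbauer_weight :: "nat \<Rightarrow> real \<Rightarrow> real" where
  "gegenbauer_weight n t = (1 - t\<^sup>2) powr ((real n - 3) / 2) * indicator {-1..1} t"

lemma gegenbauer_weight_nonneg: "0 \<le> gegenbauer_weight n t"
  by (simp add: gegenbauer_weight_def)

lemma gegenbauer_weight_pos: "t \<in> {-1<..<1} \<Longrightarrow> 0 < gegenbauer_weight n t"
  by (auto simp: gegenbauer_weight_def abs_square_less_1 abs_square_eq_1)

lemma gegenbauer_weight_measurable [measurable]: "gegenbauer_weight n \<in> borel_measurable borel"
  unfolding gegenbauer_weight_def by measurable

lemma poly_borel_measurable [measurable]: "poly (p :: real poly) \<in> borel_measurable borel"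
  by (intro borel_measurable_continuous_onI continuous_intros)

text \<open>For \<open>n = 2\<close> the weight is unbounded at the end points; it is the derivative of the arcsine. All other
  weights are dominated by this one.\<close>

lemma gegenbauer_weight_2_integrable: "integrable lborel (gegenbauer_weight 2)"
proof -
  have "((\<lambda>t. inverse (sqrt (1 - t\<^sup>2))) has_integral (arcsin 1 - arcsin (-1))) {-1..1}"
    by (rule fundamental_theorem_of_calculus_interior)
       (auto intro!: continuous_on_arcsin' DERIV_arcsin continuous_intros
             simp: has_real_derivative_iff_has_vector_derivative[symmetric])
  moreover have eq: "gegenbauer_weight 2 t = inverse (sqrt (1 - t\<^sup>2))" if "t \<in> {-1..1}" for t
  proof -
    have "0 \<le> 1 - t\<^sup>2" using that by (simp add: abs_square_le_1 abs_le_iff)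
    then have "(1 - t\<^sup>2) powr (- 1 / 2) = inverse (sqrt (1 - t\<^sup>2))"
      by (simp add: powr_minus powr_half_sqrt[symmetric])
    then show ?thesis using that by (simp add: gegenbauer_weight_def)
  qed
  ultimately have "gegenbauer_weight 2 integrable_on {-1..1}"
    by (metis (mono_tags, lifting) has_integral_cong integrable_on_def)
  then have "gegenbauer_weight 2 absolutely_integrable_on {-1..1}"
    by (rule nonnegative_absolutely_integrable_1) (simp add: gegenbauer_weight_nonneg)
  then have "integrable lebesgue (\<lambda>t. indicator {-1..1} t *\<^sub>R gegenbauer_weight 2 t)"
    by (simp add: set_integrable_def)
  also have "(\<lambda>t. indicator {-1..1} t *\<^sub>R gegenbauer_weight 2 t) = gegenbauer_weight 2"
    by (auto simp: gegenbauer_weight_def indicator_def)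
  finally show ?thesis by (simp add: integrable_completion)
qed

lemma gegenbauer_weight_le:
  assumes "n \<ge> 2"
  shows "gegenbauer_weight n t \<le> gegenbauer_weight 2 t"
proof (cases "t \<in> {-1<..<1}")
  case True
  then have "0 < 1 - t\<^sup>2" "1 - t\<^sup>2 \<le> 1" by (auto simp: abs_square_less_1)
  then have "(1 - t\<^sup>2) powr ((real n - 3) / 2) \<le> (1 - t\<^sup>2) powr ((real 2 - 3) / 2)"
    using assms by (intro powr_mono') auto
  then show ?thesis by (simp add: gegenbauer_weight_def indicator_def)
next
  case False
  then have "t \<notin> {-1..1} \<or> t = 1 \<or> t = -1" by auto
  then show ?thesis by (auto simp: gegenbauer_weight_def)
qed

lemma gegenbauer_weight_poly_integrable:
  assumes "n \<ge> 2"
  shows "integrable lborel (\<lambda>t. gegenbauer_weight n t * poly p t)"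
proof -
  have "bounded (poly p ` {-1..1})"
    by (intro compact_imp_bounded compact_continuous_image continuous_intros) auto
  then obtain K where K: "\<And>t. t \<in> {-1..1} \<Longrightarrow> \<bar>poly p t\<bar> \<le> K"
    by (force simp: bounded_iff)
  show ?thesis
  proof (rule Bochner_Integration.integrable_bound)
    show "integrable lborel (\<lambda>t. K * gegenbauer_weight 2 t)"
      by (intro integrable_mult_right gegenbauer_weight_2_integrable)
    show "AE t in lborel. norm (gegenbauer_weight n t * poly p t) \<le> norm (K * gegenbauer_weight 2 t)"
    proof (intro AE_I2)
      fix t
      show "norm (gegenbauer_weight n t * poly p t) \<le> norm (K * gegenbauer_weight 2 t)"
      proof (cases "t \<in> {-1..1}")
        case True
        have "norm (gegenbauer_weight n t * poly p t) = \<bar>poly p t\<bar> * gegenbauer_weight n t"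
          by (simp add: abs_mult gegenbauer_weight_nonneg)
        also have "\<dots> \<le> K * gegenbauer_weight 2 t"
          using K[OF True] gegenbauer_weight_le[OF assms] gegenbauer_weight_nonneg
          by (intro mult_mono) auto
        finally show ?thesis by simp
      qed (simp add: gegenbauer_weight_def)
    qed
  qed simp
qed

lemma gegenbauer_weight_poly_integral_pos:
  assumes "n \<ge> 2" "p \<noteq> 0" "\<And>t. t \<in> {-1..1} \<Longrightarrow> 0 \<le> poly p t"
  shows "0 < (\<integral>t. gegenbauer_weight n t * poly p t \<partial>lborel)"
proof -
  let ?f = "\<lambda>t. gegenbauer_weight n t * poly p t"
  have int: "integrable lborel ?f" by (rule gegenbauer_weight_poly_integrable[OF assms(1)])
  have nn: "0 \<le> ?f t" for t
    using assms(3)[of t] by (cases "t \<in> {-1..1}") (auto simp: gegenbauer_weight_def)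
  have "integral\<^sup>L lborel ?f \<noteq> 0"
  proof
    assume "integral\<^sup>L lborel ?f = 0"
    then have "AE t in lborel. ?f t = 0"
      using integral_nonneg_eq_0_iff_AE[OF int] nn by simp
    moreover have "finite {t. poly p t = 0}" using assms(2) poly_roots_finite by blast
    then have "AE t in lborel. t \<notin> {t. poly p t = 0}"
      by (intro AE_not_in finite_imp_null_set_lborel)
    ultimately have "AE t in lborel. t \<notin> {-1<..<1::real}"
      by eventually_elim (use gegenbauer_weight_pos[of _ n] in force)
    then have "{-1<..<1::real} \<in> null_sets lborel"
      using AE_iff_null_sets[of "{-1<..<1::real}" lborel] by simp
    then show False by (simp add: null_sets_def)
  qed
  moreover have "0 \<le> integral\<^sup>L lborel ?f" using nn by (rule Bochner_Integration.integral_nonneg)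
  ultimately show ?thesis by simp
qed

lemma gegenbauer_const_eq: "gegenbauer_const n = 1 / (\<integral>t. gegenbauer_weight n t \<partial>lborel)"
  by (simp add: gegenbauer_const_def set_lebesgue_integral_def gegenbauer_weight_def mult.commute)

lemma gegenbauer_const_pos: "n \<ge> 2 \<Longrightarrow> 0 < gegenbauer_const n"
  using gegenbauer_weight_poly_integral_pos[of n 1] by (simp add: gegenbauer_const_eq)

lemma coeff_zero_eq:
  assumes "n \<ge> 2"
  shows "coeff_zero n p = gegenbauer_const n * (\<integral>t. gegenbauer_weight n t * poly p t \<partial>lborel)"
proof -
  have "coeff_zero n p = (\<integral>t. poly p t \<partial>density lborel (\<lambda>t. ennreal (gegenbauer_const n * gegenbauer_weight n t)))"
    by (simp add: coeff_zero_def gegenbauer_measure_def gegenbauer_weight_def mult.assoc)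
  also have "\<dots> = (\<integral>t. (gegenbauer_const n * gegenbauer_weight n t) *\<^sub>R poly p t \<partial>lborel)"
    using gegenbauer_const_pos[OF assms] gegenbauer_weight_nonneg[of n]
    by (intro integral_density) auto
  finally show ?thesis by (simp add: mult.assoc)
qed

lemma coeff_zero_positive_functional:
  assumes "n \<ge> 2"
  shows "positive_functional (coeff_zero n)"
proof
  note int = gegenbauer_weight_poly_integrable[OF assms]
  show "coeff_zero n (p + q) = coeff_zero n p + coeff_zero n q" for p q
    using int by (simp add: coeff_zero_eq[OF assms] distrib_left)
  show "coeff_zero n (smult c p) = c * coeff_zero n p" for c p
    by (simp add: coeff_zero_eq[OF assms] mult.left_commute[of _ c])
  show "0 < coeff_zero n p" if "p \<noteq> 0" "\<And>t. t \<in> {-1..1} \<Longrightarrow> 0 \<le> poly p t" for p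
    using gegenbauer_weight_poly_integral_pos[OF assms that] gegenbauer_const_pos[OF assms]
    by (simp add: coeff_zero_eq[OF assms])
qed

lemma coeff_zero_1: "n \<ge> 2 \<Longrightarrow> coeff_zero n 1 = 1"
  using gegenbauer_weight_poly_integral_pos[of n 1] by (simp add: coeff_zero_eq gegenbauer_const_eq)

lemma coeff_zero_reflect:
  assumes "n \<ge> 2"
  shows "coeff_zero n (pcompose p [:0, -1:]) = coeff_zero n p"
proof -
  have "(\<integral>t. gegenbauer_weight n t * poly p t \<partial>lborel) =
        (\<integral>t. gegenbauer_weight n (- t) * poly p (- t) \<partial>lborel)"
    using lborel_integral_real_affine[of "-1" "\<lambda>t. gegenbauer_weight n t * poly p t" 0] by simp
  also have "\<dots> = (\<integral>t. gegenbauer_weight n t * poly p (- t) \<partial>lborel)"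
    by (rule arg_cong[where f = "integral\<^sup>L lborel"]) (auto simp: gegenbauer_weight_def indicator_def)
  finally show ?thesis by (simp add: coeff_zero_eq[OF assms] poly_pcompose)
qed

lemma gegenbauer_weight_add_2:
  "gegenbauer_weight (n + 2) t = gegenbauer_weight n t * (1 - t\<^sup>2)"
proof (cases "t \<in> {-1<..<1}")
  case True
  then have "0 < 1 - t\<^sup>2" by (auto simp: abs_square_less_1)
  moreover have "(real (n + 2) - 3) / 2 = (real n - 3) / 2 + 1" by (simp add: field_simps)
  ultimately have "(1 - t\<^sup>2) powr ((real (n + 2) - 3) / 2) = (1 - t\<^sup>2) powr ((real n - 3) / 2) * (1 - t\<^sup>2)"
    by (simp only: powr_add powr_one)
  then show ?thesis by (simp add: gegenbauer_weight_def)
next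
  case False
  then have "t \<notin> {-1..1} \<or> t = 1 \<or> t = -1" by auto
  then show ?thesis by (auto simp: gegenbauer_weight_def)
qed

text \<open>Passing from dimension \<open>n\<close> to \<open>n + 2\<close> multiplies the weight by \<open>1 - t\<^sup>2\<close>. This is why the interior
  Lobatto nodes in dimension \<open>n\<close> are Gegenbauer zeros in dimension \<open>n + 2\<close>.\<close>

lemma coeff_zero_add_2:
  assumes "n \<ge> 2"
  shows "coeff_zero (n + 2) p = gegenbauer_const (n + 2) / gegenbauer_const n * coeff_zero n ([:1, 0, -1:] * p)"
proof -
  have "gegenbauer_weight (n + 2) t * poly p t = gegenbauer_weight n t * poly ([:1, 0, -1:] * p) t" for t
    by (simp only: gegenbauer_weight_add_2) (simp add: power2_eq_square algebra_simps)
  then show ?thesis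
    using assms gegenbauer_const_pos[OF assms] by (simp add: coeff_zero_eq)
qed

text \<open>Integration by parts: the derivative of \<open>t ^ (2 * j + 1) * (1 - t\<^sup>2) powr ((n - 1) / 2)\<close> integrates to
  zero, because this function vanishes at both end points.\<close>

lemma coeff_zero_monom_rec:
  assumes "n \<ge> 2"
  shows "(real n + 2 * real j) * coeff_zero n (monom 1 (2 * j + 2)) = (2 * real j + 1) * coeff_zero n (monom 1 (2 * j))"
proof -
  interpret positive_functional "coeff_zero n" by (rule coeff_zero_positive_functional[OF assms])
  define a where "a = (real n - 1) / 2"
  have a: "a > 0" using assms by (simp add: a_def)
  define F where "F t = t ^ (2*j+1) * (1 - t\<^sup>2) powr a" for t :: real
  define q where "q = smult (2 * real j + 1) (monom 1 (2*j) - monom 1 (2*j+2)) - smult (real n - 1) (monom 1 (2*j+2))"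
  let ?f = "\<lambda>t. gegenbauer_weight n t * poly q t"
  have "(?f has_integral (F 1 - F (-1))) {-1..1}"
  proof (rule fundamental_theorem_of_calculus_interior)
    show "continuous_on {-1..1} F"
      unfolding F_def using a
      by (intro continuous_intros continuous_on_powr') (auto simp: abs_square_le_1 abs_le_iff)
    fix t :: real assume t: "t \<in> {-1<..<1}"
    then have pos: "0 < 1 - t\<^sup>2" by (auto simp: abs_square_less_1)
    have "(F has_real_derivative ((2 * real j + 1) * t ^ (2*j) * (1 - t\<^sup>2) powr a
        + t ^ (2*j+1) * (a * (1 - t\<^sup>2) powr (a - 1) * (- 2 * t)))) (at t)"
    proof -
      have "((\<lambda>t. t ^ (2*j+1)) has_real_derivative (2 * real j + 1) * t ^ (2*j)) (at t)"
        using DERIV_pow[of "2*j+1" t UNIV] by (simp add: add.commute)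
      moreover have "((\<lambda>t. (1 - t\<^sup>2) powr a) has_real_derivative (a * (1 - t\<^sup>2) powr (a - 1) * (- 2 * t))) (at t)"
        using pos by (auto intro!: derivative_eq_intros)
      ultimately show ?thesis
        unfolding F_def by (rule DERIV_cong[OF DERIV_mult]) (simp add: algebra_simps)
    qed
    also have "(2 * real j + 1) * t ^ (2*j) * (1 - t\<^sup>2) powr a
        + t ^ (2*j+1) * (a * (1 - t\<^sup>2) powr (a - 1) * (- 2 * t)) = ?f t"
    proof -
      have 1: "gegenbauer_weight n t = (1 - t\<^sup>2) powr (a - 1)"
        using t by (simp add: gegenbauer_weight_def a_def field_simps)
      have 2: "(1 - t\<^sup>2) powr a = (1 - t\<^sup>2) powr (a - 1) * (1 - t\<^sup>2)"
        using pos by (simp add: powr_diff)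
      have 3: "real n - 1 = 2 * a" by (simp add: a_def)
      show ?thesis
        unfolding q_def 1 2 3 by (simp add: poly_monom algebra_simps power2_eq_square)
    qed
    finally show "(F has_vector_derivative ?f t) (at t)"
      by (simp add: has_real_derivative_iff_has_vector_derivative)
  qed simp
  moreover have "(?f has_integral (\<integral>t. ?f t \<partial>lborel)) {-1..1}"
  proof -
    have "(?f has_integral (\<integral>t. ?f t \<partial>lborel)) UNIV"
      by (intro has_integral_integral_lborel gegenbauer_weight_poly_integrable assms)
    moreover have "(\<lambda>t. if t \<in> {-1..1} then ?f t else 0) = ?f"
      by (auto simp: gegenbauer_weight_def)
    ultimately show ?thesis using has_integral_restrict_UNIV[of "{-1..1}" ?f] by simp
  qed
  ultimately have "(\<integral>t. ?f t \<partial>lborel) = F 1 - F (-1)" by (rule has_integral_unique[symmetric])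
  then have "coeff_zero n q = 0" by (simp add: coeff_zero_eq[OF assms] F_def)
  then show ?thesis by (simp add: q_def L_diff L_smult algebra_simps)
qed

lemma coeff_zero_monom_even:
  assumes "n \<ge> 2"
  shows "coeff_zero n (monom 1 (2 * j)) = pochhammer (1 / 2) j / pochhammer (real n / 2) j"
proof (induction j)
  case 0
  then show ?case using coeff_zero_1[OF assms] by (simp add: one_pCons[symmetric] monom_0)
next
  case (Suc j)
  have "real n / 2 > 0" using assms by simp
  then have "pochhammer (real n / 2) j \<noteq> 0" "real n / 2 + real j \<noteq> 0"
    using pochhammer_pos[of "real n / 2" j] by auto
  moreover have "(real n / 2 + real j) * coeff_zero n (monom 1 (2 * Suc j))
      = (1 / 2 + real j) * coeff_zero n (monom 1 (2 * j))"
    using coeff_zero_monom_rec[OF assms, of j] by (simp add: algebra_simps)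
  ultimately have "coeff_zero n (monom 1 (2 * Suc j))
      = (1 / 2 + real j) * coeff_zero n (monom 1 (2 * j)) / (real n / 2 + real j)"
    by (metis nonzero_mult_div_cancel_left)
  then show ?case unfolding Suc.IH pochhammer_Suc by simp
qed

section \<open>Gegenbauer polynomials\<close>

text \<open>The sequence demanded by the definition exists and is unique: pairwise orthogonality with the
  right degrees amounts to orthogonality to all lower degrees, and the normalization at \<open>1\<close> is possible
  because all zeros lie in the open interval.\<close>

lemma gegenbauer_properties:
  assumes "n \<ge> 2"
  shows "degree (gegenbauer n l) = l"
    and "positive_functional.orthogonal (coeff_zero n) (gegenbauer n l)"
    and "poly (gegenbauer n l) 1 = 1"
proof -
  interpret positive_functional "coeff_zero n" by (rule coeff_zero_positive_functional[OF assms])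
  let ?Q = "\<lambda>P. (\<forall>l. degree (P l) = l) \<and>
     (\<forall>l m. l \<noteq> m \<longrightarrow> (\<integral>t. poly (P l) t * poly (P m) t \<partial>gegenbauer_measure n) = 0) \<and>
     (\<forall>l. poly (P l) 1 = 1)"
  let ?Q' = "\<lambda>P. (\<forall>l. degree (P l) = l) \<and> (\<forall>l. orthogonal (P l)) \<and> (\<forall>l. poly (P l) 1 = 1)"
  have L: "(\<integral>t. poly p t * poly q t \<partial>gegenbauer_measure n) = coeff_zero n (p * q)" for p q
    by (simp add: coeff_zero_def)
  have QQ': "?Q' P" if "?Q P" for P
  proof -
    have "orthogonal (P l)" for l
      unfolding orthogonal_def
    proof (intro allI impI)
      fix q :: "real poly" assume "degree q < degree (P l)"
      moreover have "P i \<noteq> 0" for i using that by (metis poly_0 zero_neq_one)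
      ultimately obtain c where q: "q = (\<Sum>i<l. smult (c i) (P i))"
        using graded_basis[of l P q] \<open>?Q P\<close> by (auto simp: coeff_eq_0)
      have "coeff_zero n (P l * P i) = 0" if "i < l" for i
        using that \<open>?Q P\<close> L by (metis less_irrefl)
      then show "coeff_zero n (P l * q) = 0"
        by (simp add: q sum_distrib_left L_sum L_smult)
    qed
    then show ?thesis using that by blast
  qed
  have Q'Q: "?Q P" if "?Q' P" for P
  proof -
    have "coeff_zero n (P l * P m) = 0" if "l \<noteq> m" for l m
    proof (cases "l < m")
      case True
      then show ?thesis using \<open>?Q' P\<close> by (subst mult.commute) (simp add: orthogonal_def)
    next
      case False
      then show ?thesis using \<open>?Q' P\<close> that by (simp add: orthogonal_def)
    qed
    then show ?thesis using that L by auto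
  qed
  have "\<exists>!P. ?Q P"
  proof (rule ex_ex1I)
    have "\<forall>l. \<exists>p. degree p = l \<and> orthogonal p \<and> poly p 1 = 1"
    proof
      fix l
      obtain p where p: "degree p = l" "p \<noteq> 0" "orthogonal p" using orthogonal_exists by blast
      then have "poly p 1 \<noteq> 0" using orthogonal_zeros(2)[of p] by auto
      then show "\<exists>p. degree p = l \<and> orthogonal p \<and> poly p 1 = 1"
        using p by (intro exI[of _ "smult (1 / poly p 1) p"]) (auto simp: orthogonal_def L_smult)
    qed
    then obtain P where "\<And>l. degree (P l) = l \<and> orthogonal (P l) \<and> poly (P l) 1 = 1"
      using choice[of "\<lambda>l p. degree p = l \<and> orthogonal p \<and> poly p 1 = 1"] by blast
    then have "?Q P" by (intro Q'Q) blast
    then show "\<exists>P. ?Q P" by (rule exI[of ?Q P])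
  next
    fix P R assume "?Q P" "?Q R"
    then have PR: "?Q' P" "?Q' R" using QQ' by blast+
    show "P = R"
    proof
      fix l
      have "P l \<noteq> 0" "R l \<noteq> 0" using PR by (metis poly_0 zero_neq_one)+
      then have *: "smult (lead_coeff (R l)) (P l) = smult (lead_coeff (P l)) (R l)"
        using PR by (intro orthogonal_unique) auto
      then have "lead_coeff (R l) * poly (P l) 1 = lead_coeff (P l) * poly (R l) 1"
        by (metis poly_smult)
      then have "lead_coeff (R l) = lead_coeff (P l)" using PR by simp
      with * show "P l = R l" using \<open>P l \<noteq> 0\<close> by (simp add: smult_eq_iff)
    qed
  qed
  then have "?Q (gegenbauer n)" unfolding gegenbauer_def by (rule theI')
  then have "?Q' (gegenbauer n)" by (rule QQ')
  then show "degree (gegenbauer n l) = l"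
    "orthogonal (gegenbauer n l)" "poly (gegenbauer n l) 1 = 1" by blast+
qed

lemma gegenbauer_nonzero: "n \<ge> 2 \<Longrightarrow> gegenbauer n l \<noteq> 0"
  using gegenbauer_properties(3)[of n l] by auto

lemma gegenbauer_0: "n \<ge> 2 \<Longrightarrow> gegenbauer n 0 = 1"
  using gegenbauer_properties(1,3)[of n 0] by (auto elim!: degree_eq_zeroE simp: one_pCons)

lemma coeff_zero_gegenbauer: "n \<ge> 2 \<Longrightarrow> l > 0 \<Longrightarrow> coeff_zero n (gegenbauer n l) = 0"
  using gegenbauer_properties(1,2)[of n l]
    positive_functional.orthogonal_def[OF coeff_zero_positive_functional, of n "gegenbauer n l"]
  by (metis degree_1 mult.right_neutral)

text \<open>The functional is symmetric, so the reflected polynomial is orthogonal too, and uniqueness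
  leaves only a sign.\<close>

lemma gegenbauer_reflect:
  assumes "n \<ge> 2"
  shows "pcompose (gegenbauer n l) [:0, -1:] = smult ((-1) ^ l) (gegenbauer n l)"
proof -
  interpret positive_functional "coeff_zero n" by (rule coeff_zero_positive_functional[OF assms])
  let ?p = "gegenbauer n l" and ?r = "\<lambda>p :: real poly. pcompose p [:0, -1:]"
  have rr: "?r (?r q) = q" for q :: "real poly"
    by (rule poly_eqI) (simp add: coeff_reflect flip: mult.assoc power_add)
  have deg: "degree (?r q) = degree q" for q :: "real poly" by (simp add: degree_pcompose)
  have "orthogonal (?r ?p)"
    unfolding orthogonal_def deg
  proof (intro allI impI)
    fix q :: "real poly" assume "degree q < degree ?p"
    then have "coeff_zero n (?p * ?r q) = 0"
      using gegenbauer_properties(2)[OF assms] deg by (simp add: orthogonal_def)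
    then have "coeff_zero n (?r (?p * ?r q)) = 0" by (simp add: coeff_zero_reflect[OF assms])
    then show "coeff_zero n (?r ?p * q) = 0" by (simp add: pcompose_mult rr)
  qed
  then have "smult (lead_coeff (?r ?p)) ?p = smult (lead_coeff ?p) (?r ?p)"
    using gegenbauer_properties(2)[OF assms] gegenbauer_nonzero[OF assms] deg
    by (intro orthogonal_unique) auto
  moreover have "lead_coeff (?r ?p) = (-1) ^ l * lead_coeff ?p"
    by (simp only: deg coeff_reflect gegenbauer_properties(1)[OF assms])
  ultimately have "smult (lead_coeff ?p) (smult ((-1)^l) ?p) = smult (lead_coeff ?p) (?r ?p)"
    by (simp add: mult.commute)
  then show ?thesis using gegenbauer_nonzero[OF assms] by (metis leading_coeff_0_iff smult_eq_iff)
qed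

lemma gegenbauer_even_poly: "n \<ge> 2 \<Longrightarrow> even_poly (gegenbauer n (2 * i))"
  by (simp add: even_poly_def gegenbauer_reflect)

lemma gegenbauer_root_uminus:
  assumes "n \<ge> 2"
  shows "poly (gegenbauer n l) (- x) = 0 \<longleftrightarrow> poly (gegenbauer n l) x = 0"
  using arg_cong[OF gegenbauer_reflect[OF assms, of l], of "\<lambda>p. poly p x"]
  by (simp add: poly_pcompose)

lemma gegenbauer_zero_bij_betw:
  assumes "n \<ge> 2"
  shows "bij_betw (gegenbauer_zero n l) {1..l} {x. poly (gegenbauer n l) x = 0}"
    and "{x. poly (gegenbauer n l) x = 0} \<subseteq> {-1<..<1}"
proof -
  interpret positive_functional "coeff_zero n" by (rule coeff_zero_positive_functional[OF assms])
  note g = gegenbauer_properties[OF assms, of l] gegenbauer_nonzero[OF assms, of l]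
  have "finite {x. poly (gegenbauer n l) x = 0}" using g(4) poly_roots_finite by blast
  from sorted_list_nth_bij_betw[OF this]
  show "bij_betw (gegenbauer_zero n l) {1..l} {x. poly (gegenbauer n l) x = 0}"
    using orthogonal_zeros(1)[OF g(2,4)] g(1) by (simp add: gegenbauer_zero_def[abs_def])
  show "{x. poly (gegenbauer n l) x = 0} \<subseteq> {-1<..<1}"
    by (rule orthogonal_zeros(2)[OF g(2,4)])
qed

section \<open>Spherical designs as averaging sets\<close>

text \<open>The power \<open>(u \<bullet> v) ^ d\<close> is the inner product of the \<open>d\<close>-th tensor powers, whose coordinates are
  indexed by words of length \<open>d\<close>.\<close>

lemma inner_power_eq_sum_words:
  fixes u v :: "real ^ 'n"
  shows "(u \<bullet> v) ^ d = (\<Sum>w\<in>PiE {..<d} (\<lambda>_. UNIV). (\<Prod>i<d. u $ w i) * (\<Prod>i<d. v $ w i))"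
proof -
  have "(u \<bullet> v) ^ d = (\<Prod>i<d. \<Sum>c\<in>UNIV. u $ c * v $ c)"
    by (simp add: inner_vec_def)
  also have "\<dots> = (\<Sum>w\<in>PiE {..<d} (\<lambda>_. UNIV). \<Prod>i<d. u $ w i * v $ w i)"
    by (rule prod_sum_PiE) auto
  finally show ?thesis by (simp add: prod.distrib)
qed

text \<open>The hypothesis says that a signed combination of tensor powers has norm zero; so it vanishes, and
  with it its inner product with any tensor power.\<close>

lemma inner_power_kernel_definite:
  fixes v :: "'i \<Rightarrow> real ^ 'n"
  assumes "(\<Sum>p\<in>P. \<Sum>q\<in>P. a p * a q * (v p \<bullet> v q) ^ d) = 0"
  shows "(\<Sum>p\<in>P. a p * (x \<bullet> v p) ^ d) = 0"
proof -
  define W where "W = PiE {..<d} (\<lambda>_. UNIV :: 'n set)"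
  define m where "m w u = (\<Prod>i<d. u $ w i)" for w and u :: "real ^ 'n"
  have finW: "finite W" unfolding W_def by (intro finite_PiE) auto
  have pow: "(u \<bullet> u') ^ d = (\<Sum>w\<in>W. m w u * m w u')" for u u'
    by (simp add: inner_power_eq_sum_words W_def m_def)
  have "0 = (\<Sum>p\<in>P. \<Sum>q\<in>P. \<Sum>w\<in>W. (a p * m w (v p)) * (a q * m w (v q)))"
    using assms by (simp add: pow sum_distrib_left mult_ac)
  also have "\<dots> = (\<Sum>w\<in>W. (\<Sum>p\<in>P. a p * m w (v p)) * (\<Sum>q\<in>P. a q * m w (v q)))"
    unfolding sum_product by (subst sum.swap[of _ W], subst sum.swap[of _ W], rule refl)
  finally have "(\<Sum>w\<in>W. (\<Sum>p\<in>P. a p * m w (v p)) ^ 2) = 0" by (simp add: power2_eq_square)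
  then have z: "(\<Sum>p\<in>P. a p * m w (v p)) = 0" if "w \<in> W" for w
    using that finW by (simp add: sum_nonneg_eq_0_iff)
  have "(\<Sum>p\<in>P. a p * (x \<bullet> v p) ^ d) = (\<Sum>p\<in>P. \<Sum>w\<in>W. m w x * (a p * m w (v p)))"
    by (simp add: pow sum_distrib_left mult_ac)
  also have "\<dots> = (\<Sum>w\<in>W. m w x * (\<Sum>p\<in>P. a p * m w (v p)))"
    by (subst sum.swap) (simp add: sum_distrib_left)
  finally show ?thesis using z by simp
qed

text \<open>The moments of a centred Gaussian variable; with variance \<open>1 / 2\<close> they are Pochhammer symbols
  without powers of two.\<close>

definition gauss_moment :: "nat \<Rightarrow> real" where
  "gauss_moment i = (if even i then pochhammer (1 / 2) (i div 2) else 0)"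

text \<open>Prescribing finitely many moments is a Lagrange interpolation problem: integrate the fundamental
  polynomials of arbitrary nodes. The weights may be negative, which does no harm, since they enter
  only through identities between moments.\<close>

lemma gauss_moment_quadrature:
  "\<exists>c :: nat \<Rightarrow> real. \<forall>i\<le>m. (\<Sum>p\<le>m. c p * real p ^ i) = gauss_moment i"
proof -
  \<comment> \<open>the Gaussian integral, truncated at degree \<open>m\<close>\<close>
  define \<Lambda> where "\<Lambda> f = (\<Sum>j\<le>m. coeff f j * gauss_moment j)" for f
  define c where "c p = \<Lambda> (lagrange_fundamental {..m} real p)" for p
  have "(\<Sum>p\<le>m. c p * real p ^ i) = gauss_moment i" if "i \<le> m" for i
  proof -
    have "monom 1 i = (\<Sum>p\<le>m. smult (poly (monom 1 i) (real p)) (lagrange_fundamental {..m} real p))"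
      using that by (intro lagrange_interpolation) (auto simp: degree_monom_eq)
    then have "\<Lambda> (monom 1 i) = \<Lambda> (\<Sum>p\<le>m. smult (real p ^ i) (lagrange_fundamental {..m} real p))"
      by (simp add: poly_monom)
    also have "\<dots> = (\<Sum>p\<le>m. c p * real p ^ i)"
      unfolding \<Lambda>_def c_def coeff_sum sum_distrib_right
      by (subst sum.swap) (simp add: mult_ac)
    also have "\<Lambda> (monom 1 i) = gauss_moment i"
      using that by (simp add: \<Lambda>_def if_distrib[of "\<lambda>x. x * _"] sum.delta cong: if_cong)
    finally show ?thesis ..
  qed
  then show ?thesis by blast
qed

lemma sum_even_index:
  fixes f :: "nat \<Rightarrow> real"
  shows "(\<Sum>i\<le>2 * j. if even i then f i else 0) = (\<Sum>i\<le>j. f (2 * i))"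
  by (induction j) simp_all

lemma pochhammer_half_binomial:
  assumes "i \<le> j"
  shows "real ((2 * j) choose (2 * i)) * pochhammer (1 / 2) i * pochhammer (1 / 2) (j - i)
       = real (j choose i) * pochhammer (1 / 2) j"
proof -
  have p: "pochhammer (1 / 2) m = (fact (2 * m) :: real) / (4 ^ m * fact m)" for m
    using fact_double[where 'a = real, of m] power_mult[of "2::real" 2 m] by (simp add: field_simps)
  have "real ((2 * j) choose (2 * i)) = fact (2 * j) / (fact (2 * i) * fact (2 * (j - i)))"
    using assms by (simp add: binomial_fact diff_mult_distrib2)
  moreover have "real (j choose i) = fact j / (fact i * fact (j - i))"
    using assms by (simp add: binomial_fact)
  moreover have "(4::real) ^ j = 4 ^ i * 4 ^ (j - i)" using assms by (simp flip: power_add)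
  ultimately show ?thesis by (simp add: p)
qed

text \<open>In probabilistic terms: the sum of independent centred Gaussian variables is Gaussian and the
  variances add.\<close>

lemma gauss_moment_convolution:
  "(\<Sum>i\<le>d. real (d choose i) * (a ^ i * gauss_moment i) * (gauss_moment (d - i) * r ^ ((d - i) div 2)))
    = gauss_moment d * (a\<^sup>2 + r) ^ (d div 2)"
proof (cases "even d")
  case False
  have "gauss_moment i * gauss_moment (d - i) = 0" if "i \<le> d" for i
    using that False by (auto simp: gauss_moment_def)
  then have "(\<Sum>i\<le>d. real (d choose i) * (a ^ i * gauss_moment i) * (gauss_moment (d - i) * r ^ ((d - i) div 2))) = 0"
    by (intro sum.neutral) auto
  with False show ?thesis by (simp add: gauss_moment_def)
next
  case True
  then obtain j where d: "d = 2 * j" by auto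
  have "(\<Sum>i\<le>d. real (d choose i) * (a ^ i * gauss_moment i) * (gauss_moment (d - i) * r ^ ((d - i) div 2)))
     = (\<Sum>i\<le>2*j. if even i then real ((2*j) choose i) * (a ^ i * pochhammer (1/2) (i div 2))
            * (pochhammer (1/2) ((2*j - i) div 2) * r ^ ((2*j - i) div 2)) else 0)"
    unfolding d by (intro sum.cong refl) (auto simp: gauss_moment_def)
  also have "\<dots> = (\<Sum>i\<le>j. real ((2*j) choose (2*i)) * (a ^ (2*i) * pochhammer (1/2) i)
            * (pochhammer (1/2) (j - i) * r ^ (j - i)))"
    unfolding sum_even_index by (intro sum.cong refl) (simp add: diff_mult_distrib2[symmetric])
  also have "\<dots> = (\<Sum>i\<le>j. pochhammer (1/2) j * (real (j choose i) * (a\<^sup>2) ^ i * r ^ (j - i)))"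
  proof (intro sum.cong refl)
    fix i assume "i \<in> {..j}"
    then have "real ((2*j) choose (2*i)) * pochhammer (1/2) i * pochhammer (1/2) (j - i) * (a ^ (2*i) * r ^ (j - i))
        = real (j choose i) * pochhammer (1 / 2) j * (a ^ (2*i) * r ^ (j - i))"
      by (simp only: pochhammer_half_binomial atMost_iff)
    then show "real ((2*j) choose (2*i)) * (a ^ (2*i) * pochhammer (1/2) i) * (pochhammer (1/2) (j - i) * r ^ (j - i))
      = pochhammer (1/2) j * (real (j choose i) * (a\<^sup>2) ^ i * r ^ (j - i))"
      unfolding power_mult[of a 2 i] by (simp only: mult_ac)
  qed
  also have "\<dots> = gauss_moment d * (a\<^sup>2 + r) ^ (d div 2)"
    by (simp add: d gauss_moment_def binomial_ring sum_distrib_left)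
  finally show ?thesis .
qed

text \<open>The signed mean over a product grid, in which the coordinates are independent and each has
  the weights \<open>c\<close> at the nodes \<open>0, \<dots>, m\<close>.\<close>

definition grid_mean :: "(nat \<Rightarrow> real) \<Rightarrow> nat \<Rightarrow> 'c set \<Rightarrow> (('c \<Rightarrow> nat) \<Rightarrow> real) \<Rightarrow> real" where
  "grid_mean c m A f = (\<Sum>z\<in>PiE A (\<lambda>_. {..m}). (\<Prod>a\<in>A. c (z a)) * f z)"

lemma grid_mean_empty: "grid_mean c m {} f = f (\<lambda>_. undefined)"
  by (simp add: grid_mean_def)

text \<open>Fubini for one additional coordinate, for integrands that are sums of products of a function of the
  new coordinate and a function of the others.\<close>

lemma grid_mean_insert:
  assumes "finite A" "a \<notin> A" and f: "\<And>p z. f (z(a := p)) = (\<Sum>i\<in>J. g i p * h i z)"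
    and h: "\<And>i p z. h i (z(a := p)) = h i z"
  shows "grid_mean c m (insert a A) f = (\<Sum>i\<in>J. (\<Sum>p\<le>m. c p * g i p) * grid_mean c m A (h i))"
proof -
  have inj: "inj_on (\<lambda>(p, z). z(a := p)) ({..m} \<times> PiE A (\<lambda>_. {..m}))"
    using assms(2) by (rule inj_combinator)
  have pr: "(\<Prod>b\<in>A. c ((z(a := p)) b)) = (\<Prod>b\<in>A. c (z b))" for p z
    using assms(2) by (intro prod.cong) auto
  have "grid_mean c m (insert a A) f
      = (\<Sum>(p, z)\<in>{..m} \<times> PiE A (\<lambda>_. {..m}). (c p * (\<Prod>b\<in>A. c (z b))) * f (z(a := p)))"
    unfolding grid_mean_def PiE_insert_eq using assms(1,2) pr
    by (subst sum.reindex[OF inj]) (simp add: case_prod_unfold fun_upd_same del: fun_upd_apply)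
  also have "\<dots> = (\<Sum>p\<le>m. \<Sum>z\<in>PiE A (\<lambda>_. {..m}). \<Sum>i\<in>J. (c p * g i p) * ((\<Prod>b\<in>A. c (z b)) * h i z))"
    unfolding sum.cartesian_product[symmetric] f sum_distrib_left by (simp only: mult_ac)
  also have "\<dots> = (\<Sum>p\<le>m. \<Sum>i\<in>J. \<Sum>z\<in>PiE A (\<lambda>_. {..m}). (c p * g i p) * ((\<Prod>b\<in>A. c (z b)) * h i z))"
    by (intro sum.cong refl sum.swap)
  also have "\<dots> = (\<Sum>i\<in>J. \<Sum>p\<le>m. \<Sum>z\<in>PiE A (\<lambda>_. {..m}). (c p * g i p) * ((\<Prod>b\<in>A. c (z b)) * h i z))"
    by (rule sum.swap)
  also have "\<dots> = (\<Sum>i\<in>J. (\<Sum>p\<le>m. c p * g i p) * grid_mean c m A (h i))"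
    unfolding grid_mean_def sum_product by simp
  finally show ?thesis .
qed

text \<open>Rotation invariance: the moments of a linear form depend on its coefficient vector only through
  the length.\<close>

lemma grid_mean_linear_power:
  assumes c: "\<And>i. i \<le> m \<Longrightarrow> (\<Sum>p\<le>m. c p * real p ^ i) = gauss_moment i"
    and "finite A" "d \<le> m"
  shows "grid_mean c m A (\<lambda>z. (\<Sum>a\<in>A. x a * real (z a)) ^ d) = gauss_moment d * (\<Sum>a\<in>A. (x a)\<^sup>2) ^ (d div 2)"
  using assms(2,3)
proof (induction A arbitrary: d rule: finite_induct)
  case empty
  then show ?case by (cases d) (auto simp: grid_mean_empty gauss_moment_def elim!: evenE)
next
  case (insert a A)
  have upd: "(\<Sum>b\<in>A. x b * real ((z(a := p)) b)) = (\<Sum>b\<in>A. x b * real (z b))" for z p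
    using insert.hyps by (intro sum.cong) auto
  have "grid_mean c m (insert a A) (\<lambda>z. (\<Sum>b\<in>insert a A. x b * real (z b)) ^ d)
     = (\<Sum>i\<le>d. (\<Sum>p\<le>m. c p * (real (d choose i) * (x a * real p) ^ i))
            * grid_mean c m A (\<lambda>z. (\<Sum>b\<in>A. x b * real (z b)) ^ (d - i)))"
  proof (rule grid_mean_insert[OF insert.hyps(1,2)])
    fix p z
    show "(\<Sum>b\<in>insert a A. x b * real ((z(a := p)) b)) ^ d
       = (\<Sum>i\<le>d. real (d choose i) * (x a * real p) ^ i * (\<Sum>b\<in>A. x b * real (z b)) ^ (d - i))"
    proof -
      have "(\<Sum>b\<in>insert a A. x b * real ((z(a := p)) b)) = x a * real p + (\<Sum>b\<in>A. x b * real (z b))"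
        using insert.hyps by (simp add: upd fun_upd_same del: fun_upd_apply)
      then show ?thesis by (simp only: binomial_ring)
    qed
  qed (simp only: upd)
  also have "\<dots> = (\<Sum>i\<le>d. real (d choose i) * (x a ^ i * gauss_moment i) *
       (gauss_moment (d - i) * (\<Sum>b\<in>A. (x b)\<^sup>2) ^ ((d - i) div 2)))"
  proof (intro sum.cong refl)
    fix i assume i: "i \<in> {..d}"
    have "(\<Sum>p\<le>m. c p * (real (d choose i) * (x a * real p) ^ i))
        = real (d choose i) * x a ^ i * (\<Sum>p\<le>m. c p * real p ^ i)"
      by (simp add: sum_distrib_left power_mult_distrib mult_ac)
    also have "(\<Sum>p\<le>m. c p * real p ^ i) = gauss_moment i" using i insert.prems by (intro c) auto
    finally show "(\<Sum>p\<le>m. c p * (real (d choose i) * (x a * real p) ^ i))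
            * grid_mean c m A (\<lambda>z. (\<Sum>b\<in>A. x b * real (z b)) ^ (d - i))
       = real (d choose i) * (x a ^ i * gauss_moment i) *
       (gauss_moment (d - i) * (\<Sum>b\<in>A. (x b)\<^sup>2) ^ ((d - i) div 2))"
      using insert.IH[of "d - i"] insert.prems by simp
  qed
  also have "\<dots> = gauss_moment d * ((x a)\<^sup>2 + (\<Sum>b\<in>A. (x b)\<^sup>2)) ^ (d div 2)"
    by (rule gauss_moment_convolution)
  finally show ?case using insert.hyps by simp
qed

text \<open>The squared length has the moments of a gamma distribution, whose shape parameters add under
  convolution.\<close>

lemma grid_mean_norm_power:
  assumes c: "\<And>i. i \<le> m \<Longrightarrow> (\<Sum>p\<le>m. c p * real p ^ i) = gauss_moment i"
    and "finite A" "2 * j \<le> m"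
  shows "grid_mean c m A (\<lambda>z. (\<Sum>a\<in>A. (real (z a))\<^sup>2) ^ j) = pochhammer (real (card A) / 2) j"
  using assms(2,3)
proof (induction A arbitrary: j rule: finite_induct)
  case empty
  then show ?case by (cases j) (auto simp: grid_mean_empty pochhammer_0_left)
next
  case (insert a A)
  have upd: "(\<Sum>b\<in>A. (real ((z(a := p)) b))\<^sup>2) = (\<Sum>b\<in>A. (real (z b))\<^sup>2)" for z p
    using insert.hyps by (intro sum.cong) auto
  have "grid_mean c m (insert a A) (\<lambda>z. (\<Sum>b\<in>insert a A. (real (z b))\<^sup>2) ^ j)
     = (\<Sum>i\<le>j. (\<Sum>p\<le>m. c p * (real (j choose i) * ((real p)\<^sup>2) ^ i))
            * grid_mean c m A (\<lambda>z. (\<Sum>b\<in>A. (real (z b))\<^sup>2) ^ (j - i)))"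
  proof (rule grid_mean_insert[OF insert.hyps(1,2)])
    fix p z
    show "(\<Sum>b\<in>insert a A. (real ((z(a := p)) b))\<^sup>2) ^ j
       = (\<Sum>i\<le>j. real (j choose i) * ((real p)\<^sup>2) ^ i * (\<Sum>b\<in>A. (real (z b))\<^sup>2) ^ (j - i))"
    proof -
      have "(\<Sum>b\<in>insert a A. (real ((z(a := p)) b))\<^sup>2) = (real p)\<^sup>2 + (\<Sum>b\<in>A. (real (z b))\<^sup>2)"
        using insert.hyps by (simp add: upd fun_upd_same del: fun_upd_apply)
      then show ?thesis by (simp only: binomial_ring)
    qed
  qed (simp only: upd)
  also have "\<dots> = (\<Sum>i\<le>j. real (j choose i) * pochhammer (1 / 2) i * pochhammer (real (card A) / 2) (j - i))"
  proof (intro sum.cong refl)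
    fix i assume i: "i \<in> {..j}"
    have "(\<Sum>p\<le>m. c p * (real (j choose i) * ((real p)\<^sup>2) ^ i))
        = real (j choose i) * (\<Sum>p\<le>m. c p * real p ^ (2 * i))"
      by (simp add: sum_distrib_left mult_ac flip: power_mult)
    also have "(\<Sum>p\<le>m. c p * real p ^ (2 * i)) = gauss_moment (2 * i)" using i insert.prems by (intro c) auto
    finally show "(\<Sum>p\<le>m. c p * (real (j choose i) * ((real p)\<^sup>2) ^ i))
            * grid_mean c m A (\<lambda>z. (\<Sum>b\<in>A. (real (z b))\<^sup>2) ^ (j - i))
       = real (j choose i) * pochhammer (1 / 2) i * pochhammer (real (card A) / 2) (j - i)"
      using insert.IH[of "j - i"] insert.prems by (simp add: gauss_moment_def)
  qed
  also have "\<dots> = pochhammer (1 / 2 + real (card A) / 2) j"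
    by (rule pochhammer_binomial_sum[symmetric])
  also have "1 / 2 + real (card A) / 2 = real (card (insert a A)) / 2"
    using insert.hyps by (simp add: field_simps)
  finally show ?case .
qed

text \<open>The code, together with the grid with weights scaled by \<open>- N / r\<close>, is a signed system of points
  for which the power kernel sums to zero. The three contributions (code against code, code against
  grid, grid against grid) are \<open>N\<^sup>2 s / r\<close>, \<open>- 2 N\<^sup>2 s / r\<close> and \<open>N\<^sup>2 s / r\<close>.\<close>

lemma design_moment:
  fixes C :: "(real ^ 'n) set"
  assumes "finite C" "C \<subseteq> sphere 0 1" "norm x = 1"
    and mom: "(\<Sum>u\<in>C. \<Sum>v\<in>C. (u \<bullet> v) ^ (2 * j))
       = (real (card C))\<^sup>2 * (pochhammer (1 / 2) j / pochhammer (real CARD('n) / 2) j)"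
  shows "(\<Sum>y\<in>C. (x \<bullet> y) ^ (2 * j)) = real (card C) * (pochhammer (1 / 2) j / pochhammer (real CARD('n) / 2) j)"
proof -
  define m where "m = 2 * j"
  obtain c :: "nat \<Rightarrow> real" where c: "\<And>i. i \<le> m \<Longrightarrow> (\<Sum>p\<le>m. c p * real p ^ i) = gauss_moment i"
    using gauss_moment_quadrature[of m] by blast
  define G where "G = PiE (UNIV :: 'n set) (\<lambda>_. {..m})"
  define W where "W z = (\<Prod>a\<in>UNIV. c (z a))" for z :: "'n \<Rightarrow> nat"
  define V where "V z = (\<chi> a. real (z a))" for z :: "'n \<Rightarrow> nat"
  have finG: "finite G" unfolding G_def by (intro finite_PiE) auto
  define s where "s = pochhammer (1 / 2 :: real) j"
  define r where "r = pochhammer (real CARD('n) / 2) j"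
  have r0: "r > 0" unfolding r_def by (intro pochhammer_pos) simp
  have lin: "(\<Sum>z\<in>G. W z * (y \<bullet> V z) ^ m) = s * (y \<bullet> y) ^ j" for y
    using grid_mean_linear_power[OF c, of UNIV m "\<lambda>a. y $ a"]
    by (simp add: grid_mean_def G_def W_def V_def inner_vec_def m_def s_def gauss_moment_def power2_eq_square)
  have nrm: "(\<Sum>z\<in>G. W z * (V z \<bullet> V z) ^ j) = r"
    using grid_mean_norm_power[OF c, of "UNIV :: 'n set" j]
    by (simp add: grid_mean_def G_def W_def V_def inner_vec_def m_def r_def power2_eq_square)
  define N where "N = real (card C)"
  define P where "P = C <+> G"
  \<comment> \<open>the code minus a multiple of the grid, scaled so that its radial moment \<open>r\<close> becomes \<open>N\<close>\<close>
  define a where "a = case_sum (\<lambda>y :: real ^ 'n. 1 :: real) (\<lambda>z. - (N / r) * W z)"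
  define v where "v = case_sum (\<lambda>y. y) V"
  have sumP: "(\<Sum>p\<in>P. f p) = (\<Sum>y\<in>C. f (Inl y)) + (\<Sum>z\<in>G. f (Inr z))" for f :: "_ \<Rightarrow> real"
    unfolding P_def using assms(1) finG by (simp add: sum.Plus)
  have unit: "y \<bullet> y = 1" if "y \<in> C" for y
    using that assms(2) by (auto simp: dot_square_norm)
  have lin': "(\<Sum>p\<in>P. a p * (y \<bullet> v p) ^ m) = (\<Sum>u\<in>C. (y \<bullet> u) ^ m) - N / r * (s * (y \<bullet> y) ^ j)" for y
    unfolding sumP by (simp add: a_def v_def lin[symmetric] sum_distrib_left sum_negf mult_ac)
  have "(\<Sum>p\<in>P. \<Sum>q\<in>P. a p * a q * (v p \<bullet> v q) ^ m) = (\<Sum>p\<in>P. a p * (\<Sum>q\<in>P. a q * (v p \<bullet> v q) ^ m))"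
    by (simp add: sum_distrib_left mult_ac)
  also have "\<dots> = (\<Sum>p\<in>P. a p * ((\<Sum>u\<in>C. (v p \<bullet> u) ^ m) - N / r * (s * (v p \<bullet> v p) ^ j)))"
    by (simp only: lin')
  also have "\<dots> = (\<Sum>y\<in>C. (\<Sum>u\<in>C. (y \<bullet> u) ^ m) - N / r * s)
     - N / r * (\<Sum>z\<in>G. W z * ((\<Sum>u\<in>C. (V z \<bullet> u) ^ m) - N / r * (s * (V z \<bullet> V z) ^ j)))"
    unfolding sumP by (simp add: a_def v_def unit sum_distrib_left sum_negf mult_ac)
  also have "(\<Sum>z\<in>G. W z * ((\<Sum>u\<in>C. (V z \<bullet> u) ^ m) - N / r * (s * (V z \<bullet> V z) ^ j)))
     = (\<Sum>u\<in>C. \<Sum>z\<in>G. W z * (u \<bullet> V z) ^ m) - N / r * s * (\<Sum>z\<in>G. W z * (V z \<bullet> V z) ^ j)"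
    unfolding right_diff_distrib sum_subtractf sum_distrib_left
    by (subst sum.swap) (simp add: inner_commute mult_ac)
  also have "(\<Sum>u\<in>C. \<Sum>z\<in>G. W z * (u \<bullet> V z) ^ m) = N * s"
    by (simp add: lin unit N_def)
  also have "(\<Sum>y\<in>C. (\<Sum>u\<in>C. (y \<bullet> u) ^ m) - N / r * s) = N\<^sup>2 * (s / r) - N * (N / r * s)"
    using mom by (simp add: sum_subtractf N_def m_def s_def r_def)
  finally have "(\<Sum>p\<in>P. \<Sum>q\<in>P. a p * a q * (v p \<bullet> v q) ^ m) = 0"
    using r0 by (simp add: nrm power2_eq_square)
  from inner_power_kernel_definite[OF this, of x]
  show ?thesis
    using assms(3) unfolding lin' by (simp add: m_def s_def r_def N_def dot_square_norm)
qed

text \<open>An even polynomial is a combination of even powers, and each of these is handled by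
  \<open>design_moment\<close>. The energies required there come from the expansion of the power in
  \<open>P\<^sub>0, P\<^sub>2, \<dots>, P\<^bsub>2k\<^esub>\<close>, of which only \<open>P\<^sub>0 = 1\<close> contributes to the double sum.\<close>

lemma design_mean:
  fixes C :: "(real ^ 'n) set"
  assumes n: "n = CARD('n)" "n \<ge> 2" and C: "kk_design k C"
    and p: "even_poly p" "degree p \<le> 2 * k" and x: "norm x = 1"
  shows "(\<Sum>y\<in>C. poly p (x \<bullet> y)) = real (card C) * coeff_zero n p"
proof -
  interpret positive_functional "coeff_zero n" by (rule coeff_zero_positive_functional[OF n(2)])
  have C': "finite C" "C \<subseteq> sphere 0 1"
    and des: "\<And>l. l \<in> {1..2 * k} \<Longrightarrow> even l \<Longrightarrow> (\<Sum>x\<in>C. \<Sum>y\<in>C. poly (gegenbauer n l) (x \<bullet> y)) = 0"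
    using C n(1) by (auto simp: kk_design_def spherical_code_def)
  have energy: "(\<Sum>u\<in>C. \<Sum>v\<in>C. poly f (u \<bullet> v)) = (real (card C))\<^sup>2 * coeff_zero n f"
    if f: "even_poly f" "degree f \<le> 2 * k" for f
  proof -
    have "\<exists>c. f = (\<Sum>i<Suc k. smult (c i) (gegenbauer n (2 * i)))"
      using f gegenbauer_properties(1) gegenbauer_nonzero gegenbauer_even_poly n(2)
      by (intro even_poly_span) (auto simp: coeff_eq_0)
    then obtain c where c: "f = (\<Sum>i<Suc k. smult (c i) (gegenbauer n (2 * i)))" by blast
    have g: "(\<Sum>u\<in>C. \<Sum>v\<in>C. poly (gegenbauer n (2 * i)) (u \<bullet> v)) = (real (card C))\<^sup>2 * coeff_zero n (gegenbauer n (2 * i))"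
      if "i < Suc k" for i
    proof (cases "i = 0")
      case True
      then show ?thesis using n(2) by (simp add: gegenbauer_0 coeff_zero_1 power2_eq_square)
    next
      case False
      then show ?thesis using des[of "2 * i"] that n(2) by (simp add: coeff_zero_gegenbauer)
    qed
    have "(\<Sum>u\<in>C. \<Sum>v\<in>C. poly f (u \<bullet> v)) = (\<Sum>u\<in>C. \<Sum>v\<in>C. \<Sum>i<Suc k. c i * poly (gegenbauer n (2 * i)) (u \<bullet> v))"
      unfolding c poly_sum poly_smult ..
    also have "\<dots> = (\<Sum>i<Suc k. c i * (\<Sum>u\<in>C. \<Sum>v\<in>C. poly (gegenbauer n (2 * i)) (u \<bullet> v)))"
      unfolding sum_distrib_left by (subst sum.swap[of _ "{..<Suc k}"], subst sum.swap[of _ "{..<Suc k}"], rule refl)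
    also have "\<dots> = (\<Sum>i<Suc k. c i * ((real (card C))\<^sup>2 * coeff_zero n (gegenbauer n (2 * i))))"
      using g by (intro sum.cong refl) auto
    also have "\<dots> = (real (card C))\<^sup>2 * coeff_zero n f"
      unfolding c L_sum L_smult sum_distrib_left by (simp only: mult_ac)
    finally show ?thesis .
  qed
  have mono: "(\<Sum>y\<in>C. (x \<bullet> y) ^ (2 * j)) = real (card C) * coeff_zero n (monom 1 (2 * j))" if "j \<le> k" for j
  proof -
    have "(\<Sum>u\<in>C. \<Sum>v\<in>C. (u \<bullet> v) ^ (2 * j)) = (real (card C))\<^sup>2 * coeff_zero n (monom 1 (2 * j))"
      using energy[of "monom 1 (2 * j)"] that by (simp add: even_poly_monom degree_monom_eq poly_monom)
    then show ?thesis
      using design_moment[OF C' x, of j] n by (simp add: coeff_zero_monom_even)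
  qed
  have p_eq: "p = (\<Sum>i\<le>2 * k. smult (coeff p i) (monom 1 i))"
    using poly_as_sum_of_monoms'[OF p(2)] by (simp add: smult_monom)
  have "(\<Sum>y\<in>C. poly p (x \<bullet> y)) = (\<Sum>y\<in>C. \<Sum>i\<le>2 * k. coeff p i * (x \<bullet> y) ^ i)"
    by (subst p_eq) (simp add: poly_sum poly_monom)
  also have "\<dots> = (\<Sum>i\<le>2 * k. coeff p i * (\<Sum>y\<in>C. (x \<bullet> y) ^ i))"
    by (subst sum.swap) (simp add: sum_distrib_left)
  also have "\<dots> = (\<Sum>i\<le>2 * k. coeff p i * (real (card C) * coeff_zero n (monom 1 i)))"
  proof (intro sum.cong refl)
    fix i assume i: "i \<in> {..2 * k}"
    show "coeff p i * (\<Sum>y\<in>C. (x \<bullet> y) ^ i) = coeff p i * (real (card C) * coeff_zero n (monom 1 i))"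
    proof (cases "even i")
      case True
      then obtain j where "i = 2 * j" by auto
      then show ?thesis using mono[of j] i by simp
    next
      case False
      then show ?thesis using p(1) by (simp add: even_poly_coeff)
    qed
  qed
  also have "\<dots> = real (card C) * coeff_zero n p"
    by (subst p_eq) (simp add: L_sum L_smult sum_distrib_left mult_ac)
  finally show ?thesis .
qed

section \<open>Hermite interpolation from below\<close>

text \<open>Rolle's theorem for all gaps between consecutive zeros at once. The new zeros are disjoint from the
  old ones, so that double zeros of \<open>f\<close> can be added afterwards. The last clause keeps the induction on the largest zero
  going: it puts the new zero to the right of all previous ones.\<close>

lemma rolle_zeros_between:
  fixes f f' :: "real \<Rightarrow> real"
  assumes "finite Z" "Z \<noteq> {}" "Z \<subseteq> {0..1}"
    and "\<And>a b. a \<in> Z \<Longrightarrow> b \<in> Z \<Longrightarrow> a < b \<Longrightarrow> continuous_on {a..b} f"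
    and der: "\<And>t. t \<in> {0<..<1} \<Longrightarrow> (f has_real_derivative f' t) (at t)"
    and "\<And>z. z \<in> Z \<Longrightarrow> f z = 0"
  shows "\<exists>Y \<subseteq> {0<..<1}. finite Y \<and> card Y + 1 = card Z \<and> Y \<inter> Z = {} \<and>
    (\<forall>y\<in>Y. f' y = 0) \<and> (\<forall>y\<in>Y. \<exists>z\<in>Z. y < z)"
  using assms(1-4,6)
proof (induction Z rule: finite_linorder_max_induct)
  case empty
  then show ?case by simp
next
  case (insert b Z)
  show ?case
  proof (cases "Z = {}")
    case True
    then show ?thesis by (intro exI[of _ "{}"]) simp
  next
    case False
    have "\<exists>Y \<subseteq> {0<..<1}. finite Y \<and> card Y + 1 = card Z \<and> Y \<inter> Z = {} \<and>
        (\<forall>y\<in>Y. f' y = 0) \<and> (\<forall>y\<in>Y. \<exists>z\<in>Z. y < z)"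
      by (rule insert.IH) (use False insert.prems in auto)
    then obtain Y where Y: "Y \<subseteq> {0<..<1}" "finite Y" "card Y + 1 = card Z" "Y \<inter> Z = {}"
      "\<forall>y\<in>Y. f' y = 0" "\<forall>y\<in>Y. \<exists>z\<in>Z. y < z"
      by blast
    define a where "a = Max Z"
    have a: "a \<in> Z" "a < b" "\<And>z. z \<in> Z \<Longrightarrow> z \<le> a" using False insert.hyps by (auto simp: a_def)
    have ab: "0 \<le> a" "b \<le> 1" using a insert.prems by auto
    have "\<exists>z>a. z < b \<and> (f has_real_derivative 0) (at z)"
    proof (rule Rolle[OF a(2)])
      show "f a = f b" using insert.prems(4) a(1) by simp
      show "continuous_on {a..b} f" using insert.prems(3) a by simp
      show "f differentiable (at x)" if "a < x" "x < b" for x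
        using der[of x] that ab by (auto simp: real_differentiable_def)
    qed
    then obtain y where y: "a < y" "y < b" "(f has_real_derivative 0) (at y)" by blast
    then have "f' y = 0" using der[of y] ab DERIV_unique[of f "f' y" y 0] by auto
    have "y \<notin> Y" using Y(6) a(3) y(1) by force
    moreover have "y \<notin> Z" using a(3) y(1) by force
    moreover have "b \<notin> Y" using Y(6) insert.hyps by force
    moreover have "b \<notin> Z" using insert.hyps by auto
    ultimately show ?thesis
      using Y y ab \<open>f' y = 0\<close> insert.hyps by (intro exI[of _ "insert y Y"]) auto
  qed
qed

lemma iterated_rolle:
  fixes F :: "nat \<Rightarrow> real \<Rightarrow> real"
  assumes "\<And>j t. j < m \<Longrightarrow> t \<in> {0<..<1} \<Longrightarrow> (F j has_real_derivative F (Suc j) t) (at t)"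
    and "finite Z" "Z \<subseteq> {0<..<1}" "card Z = m + 1" "\<And>z. z \<in> Z \<Longrightarrow> F 0 z = 0"
  shows "\<exists>\<xi>\<in>{0<..<1}. F m \<xi> = 0"
  using assms
proof (induction m arbitrary: F Z)
  case 0
  then obtain z where "z \<in> Z" by fastforce
  then show ?case using 0 by blast
next
  case (Suc m)
  have der: "(F 0 has_real_derivative F 1 t) (at t)" if "t \<in> {0<..<1}" for t
    using Suc.prems(1)[of 0 t] that by simp
  have "\<exists>Y \<subseteq> {0<..<1}. finite Y \<and> card Y + 1 = card Z \<and> Y \<inter> Z = {} \<and>
    (\<forall>y\<in>Y. F 1 y = 0) \<and> (\<forall>y\<in>Y. \<exists>z\<in>Z. y < z)"
  proof (rule rolle_zeros_between[where f = "F 0"])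
    show "continuous_on {a..b} (F 0)" if "a \<in> Z" "b \<in> Z" for a b
    proof (intro continuous_at_imp_continuous_on ballI)
      fix t assume "t \<in> {a..b}"
      then have "t \<in> {0<..<1}" using that Suc.prems(3) by force
      then show "isCont (F 0) t" using der DERIV_isCont by blast
    qed
  qed (use Suc.prems der in auto)
  then obtain Y where Y: "Y \<subseteq> {0<..<1}" "finite Y" "card Y = m + 1" "\<forall>y\<in>Y. F 1 y = 0"
    using Suc.prems(4) by auto
  show ?case
    using Suc.IH[of "\<lambda>j. F (Suc j)" Y] Suc.prems(1) Y by auto
qed

text \<open>The error formula of Hermite interpolation, in the form of a mean value theorem: if \<open>f - P\<close> has
  \<open>k + 2\<close> zeros, where those in \<open>D\<close> count twice, then its derivative of order \<open>k + 1\<close> has a zero,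
  and for \<open>P\<close> that derivative is a constant. Continuity is required only between the zeros, so that
  \<open>f\<close> may be unbounded near an end point that is not a node.\<close>

lemma hermite_remainder:
  fixes f :: "real \<Rightarrow> real"
  assumes diff: "\<And>j t. j \<le> k \<Longrightarrow> t \<in> {0<..<1} \<Longrightarrow> (deriv ^^ j) f differentiable (at t)"
    and Z: "finite Z" "Z \<subseteq> {0..1}" "D \<subseteq> Z" "D \<subseteq> {0<..<1}" "card Z + card D = k + 2"
    and cont: "\<And>a b. a \<in> Z \<Longrightarrow> b \<in> Z \<Longrightarrow> a < b \<Longrightarrow> continuous_on {a..b} f"
    and val: "\<And>z. z \<in> Z \<Longrightarrow> f z = poly P z" "\<And>d. d \<in> D \<Longrightarrow> deriv f d = poly (pderiv P) d"
    and P: "\<And>i. i > k + 1 \<Longrightarrow> coeff P i = 0"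
  shows "\<exists>\<xi>\<in>{0<..<1}. (deriv ^^ (k + 1)) f \<xi> = fact (k + 1) * coeff P (k + 1)"
proof -
  define F where "F j t = (deriv ^^ j) f t - poly ((pderiv ^^ j) P) t" for j t
  have der: "(F j has_real_derivative F (Suc j) t) (at t)" if "j \<le> k" "t \<in> {0<..<1}" for j t
    unfolding F_def using diff[OF that] that(2)
    by (auto intro!: derivative_eq_intros poly_DERIV simp: DERIV_deriv_iff_real_differentiable)
  have "Z \<noteq> {}" using Z by auto
  have "\<exists>Y \<subseteq> {0<..<1}. finite Y \<and> card Y + 1 = card Z \<and> Y \<inter> Z = {} \<and>
    (\<forall>y\<in>Y. F 1 y = 0) \<and> (\<forall>y\<in>Y. \<exists>z\<in>Z. y < z)"
  proof (rule rolle_zeros_between[where f = "F 0"])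
    show "continuous_on {a..b} (F 0)" if "a \<in> Z" "b \<in> Z" "a < b" for a b
      unfolding F_def using cont[OF that] by (auto intro!: continuous_intros)
    show "(F 0 has_real_derivative F 1 t) (at t)" if "t \<in> {0<..<1}" for t
      using der[of 0 t] that by simp
    show "F 0 z = 0" if "z \<in> Z" for z using val(1)[OF that] by (simp add: F_def)
  qed (use Z \<open>Z \<noteq> {}\<close> in auto)
  then obtain Y where Y: "Y \<subseteq> {0<..<1}" "finite Y" "card Y + 1 = card Z" "Y \<inter> Z = {}" "\<forall>y\<in>Y. F 1 y = 0"
    by blast
  have "finite D" using Z finite_subset by blast
  have "card (Y \<union> D) = card Y + card D"
    using Y Z \<open>finite D\<close> by (intro card_Un_disjoint) auto
  then have card: "card (Y \<union> D) = k + 1" using Y(3) Z(5) by simp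
  have "\<exists>\<xi>\<in>{0<..<1}. F (Suc k) \<xi> = 0"
  proof (rule iterated_rolle[where F = "\<lambda>j. F (Suc j)" and Z = "Y \<union> D"])
    show "F (Suc 0) z = 0" if "z \<in> Y \<union> D" for z
      using that Y(5) val(2) by (auto simp: F_def)
  qed (use der Y Z \<open>finite D\<close> card in auto)
  then obtain \<xi> where \<xi>: "\<xi> \<in> {0<..<1}" "F (Suc k) \<xi> = 0" by blast
  have c: "coeff ((pderiv ^^ Suc k) P) i = pochhammer (real (Suc i)) (Suc k) * coeff P (i + Suc k)" for i
    by (rule coeff_higher_pderiv)
  have "(pderiv ^^ Suc k) P = [:fact (Suc k) * coeff P (Suc k):]"
  proof (rule poly_eqI)
    fix i
    show "coeff ((pderiv ^^ Suc k) P) i = coeff [:fact (Suc k) * coeff P (Suc k):] i"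
      unfolding c using P[of "i + Suc k"] by (cases i) (auto simp: pochhammer_fact simp del: pochhammer_Suc)
  qed
  then show ?thesis using \<xi> by (intro bexI[of _ \<xi>]) (simp_all add: F_def del: funpow.simps)
qed

text \<open>The node polynomial \<open>w\<close> has a double zero at each interior node and a simple one at \<open>0\<close> or \<open>1\<close>. On
  \<open>[0, 1]\<close> it is nonpositive if \<open>1\<close> is a node and nonnegative otherwise, which is the sign of the
  derivative in the error formula, so the error \<open>f - G\<close> is nonnegative in both cases.\<close>

lemma hermite_minorant_exists:
  fixes f :: "real \<Rightarrow> real"
  assumes diff: "\<And>j t. j \<le> k \<Longrightarrow> t \<in> {0<..<1} \<Longrightarrow> (deriv ^^ j) f differentiable (at t)"
    and U: "finite U" "U \<subseteq> {0..1}" and D: "D = U \<inter> {0<..<1}" and card: "card U + card D = k + 1"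
    and cont: "continuous_on {0..<1} f" "1 \<in> U \<Longrightarrow> continuous_on {0..1} f"
    and sgn: "\<And>t. 1 \<notin> U \<Longrightarrow> t \<in> {0<..<1} \<Longrightarrow> (deriv ^^ (k + 1)) f t \<ge> 0"
       "\<And>t. 1 \<in> U \<Longrightarrow> t \<in> {0<..<1} \<Longrightarrow> (deriv ^^ (k + 1)) f t \<le> 0"
  shows "\<exists>G. (\<forall>i>k. coeff G i = 0) \<and> (\<forall>u\<in>U. poly G u = f u) \<and>
     (\<forall>d\<in>D. poly (pderiv G) d = deriv f d) \<and> (\<forall>u\<in>{0..<1}. poly G u \<le> f u)"
proof -
  have "D \<subseteq> U" "finite D" using D U by auto
  define wU where "wU = (\<Prod>u\<in>U. [:-u, 1:])"
  define wD where "wD = (\<Prod>u\<in>D. [:-u, 1:])"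
  have degU: "degree wU = card U" unfolding wU_def by (subst degree_prod_sum_eq) auto
  have degD: "degree wD = card D" unfolding wD_def by (subst degree_prod_sum_eq) auto
  have wU0: "poly wU u = 0" if "u \<in> U" for u using that U(1) by (auto simp: wU_def poly_prod)
  have dU: "poly (pderiv wU) d \<noteq> 0" if "d \<in> D" for d
  proof -
    have "d \<in> U" using that \<open>D \<subseteq> U\<close> by auto
    define v where "v = (\<Prod>u\<in>U - {d}. [:-u, 1:])"
    have "wU = [:-d, 1:] * v"
      unfolding wU_def v_def using U(1) \<open>d \<in> U\<close> by (rule prod.remove)
    then have "poly (pderiv wU) d = poly v d"
      by (simp only: pderiv_mult poly_add poly_mult) (simp add: pderiv_pCons)
    then show ?thesis using U(1) by (auto simp: v_def poly_prod)
  qed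
  obtain G0 where G0: "\<And>u. u \<in> U \<Longrightarrow> poly G0 u = f u" "\<And>i. i \<ge> card U \<Longrightarrow> coeff G0 i = 0"
    using interpolating_poly_exists[OF U(1), of f] by blast
  \<comment> \<open>a multiple of \<open>wU\<close> corrects the derivatives without changing the values\<close>
  obtain R where R: "\<And>d. d \<in> D \<Longrightarrow> poly R d = (deriv f d - poly (pderiv G0) d) / poly (pderiv wU) d"
      "\<And>i. i \<ge> card D \<Longrightarrow> coeff R i = 0"
    using interpolating_poly_exists[OF \<open>finite D\<close>, of "\<lambda>d. (deriv f d - poly (pderiv G0) d) / poly (pderiv wU) d"]
    by blast
  define G where "G = G0 + wU * R"
  have G_val: "poly G u = f u" if "u \<in> U" for u using G0(1) wU0 that by (simp add: G_def)
  have G_der: "poly (pderiv G) d = deriv f d" if "d \<in> D" for d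
  proof -
    have "d \<in> U" using that \<open>D \<subseteq> U\<close> by auto
    then have "poly (pderiv G) d = poly (pderiv G0) d + poly R d * poly (pderiv wU) d"
      by (simp add: G_def pderiv_add pderiv_mult wU0)
    then show ?thesis using R(1)[OF that] dU[OF that] by simp
  qed
  have G_deg: "coeff G i = 0" if "i > k" for i
  proof -
    have "coeff (wU * R) i = 0"
    proof (cases "R = 0")
      case False
      then have "degree R < card D" using R(2)[of "degree R"] by (metis leading_coeff_0_iff not_le)
      then show ?thesis
        using degree_mult_le[of wU R] degU that card by (intro coeff_eq_0) linarith
    qed simp
    then show ?thesis using G0(2)[of i] that card by (simp add: G_def)
  qed
  have G_le: "poly G u \<le> f u" if u: "u \<in> {0..<1}" for u
  proof (cases "u \<in> U")
    case True
    then show ?thesis using G_val by simp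
  next
    case False
    define w where "w = wU * wD"
    have wmonic: "lead_coeff w = 1" by (simp add: w_def wU_def wD_def lead_coeff_mult lead_coeff_prod)
    have degw: "degree w = k + 1"
      unfolding w_def using degU degD card U(1) \<open>finite D\<close>
      by (subst degree_mult_eq) (auto simp: wU_def wD_def)
    \<comment> \<open>the sign of \<open>w\<close> on \<open>[0, 1)\<close>\<close>
    define s :: real where "s = (if 1 \<in> U then -1 else 1)"
    have "wU = (\<Prod>u\<in>U - D. [:-u, 1:]) * wD"
      unfolding wU_def wD_def using \<open>D \<subseteq> U\<close> U(1) by (rule prod.subset_diff)
    then have wu: "poly w u = (\<Prod>v\<in>U - D. u - v) * (poly wD u)\<^sup>2"
      by (simp add: w_def poly_prod power2_eq_square)
    have "U - D = (if 0 \<in> U then {0} else {}) \<union> (if 1 \<in> U then {1} else {})"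
    proof -
      have "u = 0 \<or> u = 1" if "u \<in> U" "u \<notin> D" for u
        using that U(2) unfolding D by (auto simp: less_le subset_iff)
      moreover have "0 \<notin> D" "1 \<notin> D" unfolding D by auto
      ultimately show ?thesis by (auto split: if_splits)
    qed
    then have "s * (\<Prod>v\<in>U - D. u - v) \<ge> 0"
      using u by (auto simp: s_def mult_nonneg_nonpos mult_nonpos_nonneg)
    then have sw: "s * poly w u \<ge> 0" unfolding wu by (simp flip: mult.assoc)
    have w0: "poly w u \<noteq> 0" using False U(1) \<open>finite D\<close> \<open>D \<subseteq> U\<close>
      by (auto simp: w_def wU_def wD_def poly_prod)
    define K where "K = (f u - poly G u) / poly w u"
    define P where "P = G + smult K w"
    have wz: "poly w z = 0" if "z \<in> U" for z using wU0[OF that] by (simp add: w_def)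
    have wdz: "poly (pderiv w) d = 0" if "d \<in> D" for d
      using wU0[of d] that \<open>D \<subseteq> U\<close> \<open>finite D\<close>
      by (auto simp: w_def pderiv_mult) (auto simp: wD_def poly_prod)
    have "\<exists>\<xi>\<in>{0<..<1}. (deriv ^^ (k + 1)) f \<xi> = fact (k + 1) * coeff P (k + 1)"
    proof (rule hermite_remainder[where Z = "insert u U" and D = D])
      show "continuous_on {a..b} f" if "a \<in> insert u U" "b \<in> insert u U" "a < b" for a b
      proof -
        have "0 \<le> a" "b \<le> 1" using that u U(2) by auto
        show ?thesis
        proof (cases "1 \<in> U")
        case True
        then show ?thesis by (intro continuous_on_subset[OF cont(2)]) (use \<open>0 \<le> a\<close> \<open>b \<le> 1\<close> in auto)
      next
        case False
        then have "\<forall>z\<in>insert u U. z < 1" using u U(2) by (auto simp: less_le subset_iff)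
        then have "b < 1" using that by blast
        then show ?thesis by (intro continuous_on_subset[OF cont(1)]) (use \<open>0 \<le> a\<close> in auto)
      qed
      qed
      show "f z = poly P z" if "z \<in> insert u U" for z
        using that w0 wz G_val by (auto simp: P_def K_def)
      show "deriv f d = poly (pderiv P) d" if "d \<in> D" for d
        using G_der[OF that] wdz[OF that] by (simp add: P_def pderiv_add pderiv_smult)
      show "coeff P i = 0" if "i > k + 1" for i
        using that G_deg degw by (simp add: P_def coeff_eq_0)
      show "card (insert u U) + card D = k + 2" using False U(1) card by simp
    qed (use diff U D u in auto)
    then obtain \<xi> where \<xi>: "\<xi> \<in> {0<..<1}" "(deriv ^^ (k + 1)) f \<xi> = fact (k + 1) * coeff P (k + 1)" by blast
    have "coeff P (k + 1) = K" using G_deg[of "k + 1"] wmonic degw by (simp add: P_def)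
    then have "s * (deriv ^^ (k + 1)) f \<xi> = fact (k + 1) * (s * K)" using \<xi> by simp
    moreover have "s * (deriv ^^ (k + 1)) f \<xi> \<ge> 0"
      using sgn \<xi>(1) by (auto simp: s_def simp del: funpow.simps)
    ultimately have "fact (k + 1) * (s * K) \<ge> 0" by (simp only:)
    then have "s * K \<ge> 0"
      using mult_pos_neg[OF fact_gt_zero[of "k + 1", where 'a = real], of "s * K"] by (meson not_le)
    with sw have "0 \<le> (s * K) * (s * poly w u)" by simp
    also have "\<dots> = f u - poly G u" using w0 by (auto simp: K_def s_def)
    finally show ?thesis by simp
  qed
  show ?thesis using G_val G_der G_deg G_le by blast
qed

text \<open>This is what makes \<open>g 1\<close> finite if \<open>g\<^bsup>(k+1)\<^esup> \<le> 0\<close>: the error of Lagrange interpolation at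
  nodes in \<open>(0, 1/2]\<close> is nonpositive to the right of all nodes.\<close>

lemma bounded_above_by_poly_near_1:
  fixes f :: "real \<Rightarrow> real"
  assumes diff: "\<And>j t. j \<le> k \<Longrightarrow> t \<in> {0<..<1} \<Longrightarrow> (deriv ^^ j) f differentiable (at t)"
    and sgn: "\<And>t. t \<in> {0<..<1} \<Longrightarrow> (deriv ^^ (k + 1)) f t \<le> 0"
  shows "\<exists>G. \<forall>u\<in>{1/2<..<1}. f u \<le> poly G u"
proof -
  \<comment> \<open>\<open>k + 1\<close> distinct nodes in \<open>(0, 1/2]\<close>\<close>
  define Z where "Z = (\<lambda>i. 1 / (real i + 2)) ` {..k}"
  have Z: "finite Z" "Z \<subseteq> {0<..1/2}" by (auto simp: Z_def field_simps)
  have cardZ: "card Z = k + 1"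
    unfolding Z_def by (subst card_image) (auto simp: inj_on_def)
  obtain G where G: "\<And>u. u \<in> Z \<Longrightarrow> poly G u = f u" "\<And>i. i \<ge> card Z \<Longrightarrow> coeff G i = 0"
    using interpolating_poly_exists[OF Z(1), of f] by blast
  define w where "w = (\<Prod>u\<in>Z. [:-u, 1:])"
  have degw: "degree w = k + 1" unfolding w_def by (subst degree_prod_sum_eq) (auto simp: cardZ)
  have wmonic: "lead_coeff w = 1" by (simp add: w_def lead_coeff_prod)
  have "f u \<le> poly G u" if u: "u \<in> {1/2<..<1}" for u
  proof -
    have w_pos: "0 < poly w u"
      unfolding w_def poly_prod using Z(2) u by (intro prod_pos) force
    have "u \<notin> Z" using u Z(2) by force
    define K where "K = (f u - poly G u) / poly w u"
    define P where "P = G + smult K w"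
    have wz: "poly w z = 0" if "z \<in> Z" for z using that Z(1) by (auto simp: w_def poly_prod)
    have Z01: "insert u Z \<subseteq> {0<..<1}" using u Z(2) by force
    have "\<exists>\<xi>\<in>{0<..<1}. (deriv ^^ (k + 1)) f \<xi> = fact (k + 1) * coeff P (k + 1)"
    proof (rule hermite_remainder[where Z = "insert u Z" and D = "{}"])
      show "continuous_on {a..b} f" if "a \<in> insert u Z" "b \<in> insert u Z" "a < b" for a b
      proof (intro continuous_at_imp_continuous_on ballI)
        fix t assume "t \<in> {a..b}"
        then have "t \<in> {0<..<1}" using that Z01 by (meson atLeastAtMost_iff greaterThanLessThan_iff less_le_trans le_less_trans subsetD)
        then show "isCont f t" using diff[of 0 t] differentiable_imp_continuous_within by auto
      qed
      show "f z = poly P z" if "z \<in> insert u Z" for z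
        using that w_pos wz G(1) by (auto simp: P_def K_def)
      show "coeff P i = 0" if "i > k + 1" for i
        using that G(2)[of i] degw cardZ by (simp add: P_def coeff_eq_0)
      show "card (insert u Z) + card {} = k + 2" using \<open>u \<notin> Z\<close> Z(1) cardZ by simp
      show "insert u Z \<subseteq> {0..1}" using Z01 by force
    qed (use diff Z in auto)
    then obtain \<xi> where \<xi>: "\<xi> \<in> {0<..<1}" "(deriv ^^ (k + 1)) f \<xi> = fact (k + 1) * coeff P (k + 1)" by blast
    have "coeff P (k + 1) = K" using G(2)[of "k + 1"] wmonic degw cardZ by (simp add: P_def)
    then have "fact (k + 1) * K \<le> 0" using sgn[OF \<xi>(1)] \<xi>(2) by simp
    then have "K \<le> 0"
      using mult_pos_pos[OF fact_gt_zero[of "k + 1", where 'a = real], of K] by (meson not_le)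
    then show ?thesis using w_pos by (simp add: K_def divide_le_0_iff)
  qed
  then show ?thesis by blast
qed

section \<open>Optimality in the linear program\<close>

text \<open>Squaring identifies the nodes in pairs, except for \<open>0\<close>. The first count says that the interpolation
  problem in \<open>u = t\<^sup>2\<close> has as many conditions as coefficients, the second that the problem in \<open>t\<close>
  determines a polynomial of degree at most \<open>2 * k\<close>.\<close>

lemma card_squares:
  fixes X :: "real set"
  assumes "finite X" "X \<subseteq> {-1..1}" "\<And>t. t \<in> X \<Longrightarrow> - t \<in> X"
    and "card X = k + 1 + (if 1 \<in> X then 1 else 0)"
  shows "card ((\<lambda>t. t\<^sup>2) ` X) + card ((\<lambda>t. t\<^sup>2) ` X \<inter> {0<..<1}) = k + 1"
    and "card X + card (X - {-1, 0, 1}) \<ge> 2 * k + 1"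
proof -
  define U where "U = (\<lambda>t. t\<^sup>2) ` X"
  define D where "D = U \<inter> {0<..<1}"
  have U01: "U \<subseteq> {0..1}" using assms(2) by (auto simp: abs_square_le_1 abs_le_iff U_def)
  have finU: "finite U" using assms(1) by (simp add: U_def)
  have ends: "0 \<in> U \<longleftrightarrow> 0 \<in> X" "1 \<in> U \<longleftrightarrow> 1 \<in> X"
  proof -
    show "0 \<in> U \<longleftrightarrow> 0 \<in> X" by (auto simp: U_def image_iff)
    have "1 \<in> X" if "t \<in> X" "1 = t\<^sup>2" for t
      using that assms(3)[of t] by (auto simp: eq_commute[of 1] power2_eq_1_iff)
    then show "1 \<in> U \<longleftrightarrow> 1 \<in> X" by (auto simp: U_def intro: image_eqI[of _ _ 1])
  qed
  define z where "z = (if 0 \<in> X then 1 else 0 :: nat)"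
  define e where "e = (if 1 \<in> X then 1 else 0 :: nat)"
  have "U = D \<union> (U \<inter> {0, 1})" using U01 by (auto simp: D_def less_le subset_iff)
  moreover have "card (D \<union> (U \<inter> {0, 1})) = card D + card (U \<inter> {0, 1})"
      using finU by (intro card_Un_disjoint) (auto simp: D_def)
  ultimately have "card U = card D + card (U \<inter> {0, 1})" by simp
  moreover have "U \<inter> {0, 1} = (if 0 \<in> U then {0} else {}) \<union> (if 1 \<in> U then {1} else {})" by auto
  then have "card (U \<inter> {0, 1}) = z + e" unfolding ends by (auto simp: z_def e_def)
  ultimately have 1: "card U = card D + z + e" by simp
  have X: "X = sqrt ` U \<union> (\<lambda>u. - sqrt u) ` U"
  proof -
    have "t \<in> sqrt ` U \<or> t \<in> (\<lambda>u. - sqrt u) ` U" if "t \<in> X" for t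
    proof -
      have "sqrt (t\<^sup>2) = t \<or> - sqrt (t\<^sup>2) = t" by (simp add: abs_if)
      then show ?thesis using that unfolding U_def by (metis imageI)
    qed
    moreover have "sqrt (t\<^sup>2) \<in> X \<and> - sqrt (t\<^sup>2) \<in> X" if "t \<in> X" for t
      using that assms(3)[of t] by (simp add: abs_if)
    ultimately show ?thesis unfolding U_def by blast
  qed
  have "sqrt ` U \<inter> (\<lambda>u. - sqrt u) ` U = (if 0 \<in> X then {0} else {})"
  proof -
    have "s = 0" if "s = sqrt u" "s = - sqrt v" "u \<in> U" "v \<in> U" for s u v
    proof -
      have "0 \<le> sqrt u" "0 \<le> sqrt v" using that U01 by auto
      then show ?thesis using that by linarith
    qed
    then have "sqrt ` U \<inter> (\<lambda>u. - sqrt u) ` U \<subseteq> {0}" by blast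
    moreover have "0 \<in> sqrt ` U \<longleftrightarrow> 0 \<in> X" "0 \<in> (\<lambda>u. - sqrt u) ` U \<longleftrightarrow> 0 \<in> X" unfolding ends(1)[symmetric] by force+
    ultimately show ?thesis by (auto split: if_splits)
  qed
  then have "card (sqrt ` U \<inter> (\<lambda>u. - sqrt u) ` U) = z" by (simp add: z_def)
  moreover have "card (sqrt ` U) = card U" "card ((\<lambda>u. - sqrt u) ` U) = card U"
    by (intro card_image; simp add: inj_on_def)+
  ultimately have "card X + z = 2 * card U"
    using card_Un_Int[of "sqrt ` U" "(\<lambda>u. - sqrt u) ` U"] X finU by simp
  then show "card ((\<lambda>t. t\<^sup>2) ` X) + card ((\<lambda>t. t\<^sup>2) ` X \<inter> {0<..<1}) = k + 1"
    using 1 assms(4) unfolding U_def D_def by (simp add: e_def)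
  have "X \<inter> {-1, 0, 1} \<subseteq> (if 1 \<in> X then {-1, 0, 1} else {0})" using assms(3) by force
  then have "card (X \<inter> {-1, 0, 1}) \<le> card (if 1 \<in> X then {-1, 0, 1} else {0 :: real})"
    by (intro card_mono) auto
  also have "\<dots> \<le> 1 + 2 * e" by (simp add: e_def card_insert_if)
  finally have "card (X \<inter> {-1, 0, 1}) \<le> 1 + 2 * e" .
  moreover have "card X = card (X \<inter> {-1, 0, 1}) + card (X - {-1, 0, 1})"
    using assms(1) by (rule card_Int_Diff)
  ultimately show "card X + card (X - {-1, 0, 1}) \<ge> 2 * k + 1" using assms(4) by (simp add: e_def)
qed

text \<open>For a symmetric node set and a positive quadrature rule exact up to degree \<open>2 * k\<close>, the even
  Hermite interpolant is feasible and is the only maximizer. A feasible polynomial with the same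
  objective value agrees with \<open>h\<close> at all nodes, since the weights are positive; at a nonzero
  interior node the difference has a minimum, so the derivatives agree as well and the polynomial solves the
  same interpolation problem.\<close>

lemma lp_solution:
  fixes g h :: "real \<Rightarrow> ereal" and x w :: "nat \<Rightarrow> real"
  assumes n: "n \<ge> 2"
    and h: "\<forall>t\<in>{-1..1}. h t = g (t\<^sup>2)"
    and g_fin: "\<forall>u\<in>{0..1}. g u \<noteq> -\<infinity>" "\<forall>u\<in>{0..<1}. g u \<noteq> \<infinity>"
    and g_cont: "continuous_on {0..<1} g"
    and g_lim: "(g \<longlongrightarrow> g 1) (at_left 1)"
    and g_diff: "\<forall>j\<le>k. \<forall>u\<in>{0<..<1}. (deriv ^^ j) (\<lambda>v. real_of_ereal (g v)) differentiable (at u)"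
    and I: "finite I" "inj_on x I" "\<And>i. i \<in> I \<Longrightarrow> x i \<in> {-1..1}" "\<And>i. i \<in> I \<Longrightarrow> - x i \<in> x ` I"
    and card: "card I = k + 1 + (if 1 \<in> x ` I then 1 else 0)"
    and w: "\<And>i. i \<in> I \<Longrightarrow> 0 < w i"
       "\<And>f. degree f \<le> 2 * k \<Longrightarrow> coeff_zero n f = (\<Sum>i\<in>I. w i * poly f (x i))"
    and g1: "1 \<in> x ` I \<Longrightarrow> g 1 \<noteq> \<infinity>"
    and sgn: "\<And>t. 1 \<notin> x ` I \<Longrightarrow> t \<in> {0<..<1} \<Longrightarrow> (deriv ^^ (k + 1)) (\<lambda>v. real_of_ereal (g v)) t \<ge> 0"
       "\<And>t. 1 \<in> x ` I \<Longrightarrow> t \<in> {0<..<1} \<Longrightarrow> (deriv ^^ (k + 1)) (\<lambda>v. real_of_ereal (g v)) t \<le> 0"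
  shows "\<exists>H. (\<forall>G. degree G \<le> 2 * k \<and> (\<forall>i\<in>I. ereal (poly G (x i)) = h (x i)) \<and>
          (\<forall>i\<in>I. x i \<notin> {-1, 0, 1} \<longrightarrow> poly (pderiv G) (x i) = deriv (\<lambda>t. real_of_ereal (h t)) (x i)) \<longleftrightarrow> G = H)
      \<and> even_poly H \<and> H \<in> feasible_polys n k h
      \<and> (\<forall>f. is_arg_max (coeff_zero n) (\<lambda>f. f \<in> feasible_polys n k h) f \<longleftrightarrow> f = H)
      \<and> ereal (coeff_zero n H) = (\<Sum>i\<in>I. ereal (w i) * h (x i))"
proof -
  define X where "X = x ` I"
  define U where "U = (\<lambda>t. t\<^sup>2) ` X"
  define D where "D = U \<inter> {0<..<1}"
  define gr where "gr = (\<lambda>v. real_of_ereal (g v))"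
  define hr where "hr = (\<lambda>t. real_of_ereal (h t))"
  have X: "finite X" "X \<subseteq> {-1..1}" "\<And>t. t \<in> X \<Longrightarrow> - t \<in> X" using I by (auto simp: X_def)
  have cardX: "card X = k + 1 + (if 1 \<in> X then 1 else 0)"
    using card by (simp add: X_def card_image[OF I(2)])
  note cards = card_squares[OF X cardX, folded U_def, folded D_def]
  have U: "finite U" "U \<subseteq> {0..1}"
    using X by (auto simp: U_def abs_square_le_1 abs_le_iff)
  have U1: "1 \<in> U \<longleftrightarrow> 1 \<in> X"
  proof -
    have "1 \<in> X" if "t \<in> X" "1 = t\<^sup>2" for t
      using that X(3)[of t] by (auto simp: eq_commute[of 1] power2_eq_1_iff)
    then show ?thesis by (auto simp: U_def intro: image_eqI[of _ _ 1])
  qed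
  have g_gr: "g u = ereal (gr u)" if "u \<in> {0..<1}" for u
    using g_fin(1)[rule_format, of u] g_fin(2)[rule_format, of u] that by (cases "g u") (auto simp: gr_def)
  have g_gr1: "g 1 = ereal (gr 1)" if "1 \<in> X"
    using g_fin(1)[rule_format, of 1] g1 that by (cases "g 1") (auto simp: gr_def X_def)
  have gr_lim: "(gr \<longlongrightarrow> gr u) F" if "(g \<longlongrightarrow> g u) F" "g u = ereal (gr u)" for u F
  proof -
    have "(g \<longlongrightarrow> ereal (gr u)) F" using that by (simp only:)
    from lim_real_of_ereal[OF this] show ?thesis by (simp only: gr_def)
  qed
  have gr_cont: "continuous_on {0..<1} gr"
    using g_cont g_gr gr_lim unfolding continuous_on_def by blast
  have gr_cont1: "continuous_on {0..1} gr" if "1 \<in> U"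
    unfolding continuous_on_def
  proof
    fix u :: real assume u: "u \<in> {0..1}"
    show "(gr \<longlongrightarrow> gr u) (at u within {0..1})"
    proof (cases "u = 1")
      case True
      have "(gr \<longlongrightarrow> gr 1) (at_left 1)" using gr_lim[OF g_lim] g_gr1 that U1 by simp
      then show ?thesis using True by (simp add: at_within_Icc_at_left)
    next
      case False
      then have "at u within {0..1} = at u within {0..<1}"
        using u by (intro at_within_nhd[of _ "{..<1}"]) auto
      then show ?thesis using gr_cont False u by (simp add: continuous_on_def)
    qed
  qed
  have "\<exists>G. (\<forall>i>k. coeff G i = 0) \<and> (\<forall>u\<in>U. poly G u = gr u) \<and>
     (\<forall>d\<in>D. poly (pderiv G) d = deriv gr d) \<and> (\<forall>u\<in>{0..<1}. poly G u \<le> gr u)"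
    by (rule hermite_minorant_exists[OF _ U D_def cards(1) gr_cont gr_cont1])
       (use g_diff sgn U1 in \<open>auto simp: gr_def X_def simp del: funpow.simps\<close>)
  then obtain G where G: "\<And>i. i > k \<Longrightarrow> coeff G i = 0" "\<And>u. u \<in> U \<Longrightarrow> poly G u = gr u"
     "\<And>d. d \<in> D \<Longrightarrow> poly (pderiv G) d = deriv gr d" "\<And>u. u \<in> {0..<1} \<Longrightarrow> poly G u \<le> gr u" by blast
  define H where "H = pcompose G [:0, 0, 1:]"
  have H: "poly H t = poly G (t\<^sup>2)" for t
    by (simp add: H_def poly_pcompose power2_eq_square)
  have dH: "poly (pderiv H) t = poly (pderiv G) (t\<^sup>2) * (2 * t)" for t
    by (simp add: H_def pderiv_pcompose poly_pcompose pderiv_pCons power2_eq_square)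
  have H_even: "even_poly H" unfolding H_def by (rule even_poly_square_arg)
  have "degree G \<le> k" using G(1) by (intro degree_le) auto
  then have degH: "degree H \<le> 2 * k" by (simp add: H_def degree_pcompose)
  have sq: "t\<^sup>2 \<in> {0..<1}" if "t \<in> {-1<..<1}" for t :: real
    using that by (auto simp: abs_square_less_1)
  have h_in: "h t = ereal (gr (t\<^sup>2))" if "t \<in> {-1<..<1}" for t
    using that h g_gr[OF sq[OF that]] by simp
  have h_X: "h t = ereal (poly H t)" if "t \<in> X" for t
  proof (cases "t \<in> {-1<..<1}")
    case True
    have "t\<^sup>2 \<in> U" using that by (simp add: U_def)
    then show ?thesis using h_in[OF True] G(2) by (simp add: H)
  next
    case False
    then have t: "t = 1 \<or> t = -1" using subsetD[OF X(2) that] by auto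
    then have "1 \<in> X" using that X(3)[of t] by auto
    then have "1 \<in> U" using U1 by simp
    then have "g 1 = ereal (poly G 1)" using g_gr1[OF \<open>1 \<in> X\<close>] G(2) by simp
    then show ?thesis using t h by (auto simp: H)
  qed
  have H_le: "ereal (poly H t) \<le> h t" if t: "t \<in> {-1..1}" for t
  proof (cases "t \<in> {-1<..<1}")
    case True
    then show ?thesis using h_in[OF True] G(4)[OF sq[OF True]] by (simp add: H)
  next
    case False
    then have "t\<^sup>2 = 1" using t by (auto simp: power2_eq_1_iff)
    have "ereal (poly G 1) \<le> g 1"
    proof (rule tendsto_le[OF _ g_lim])
      show "((\<lambda>u. ereal (poly G u)) \<longlongrightarrow> ereal (poly G 1)) (at_left 1)"
        by (intro tendsto_intros)
      have "eventually (\<lambda>u. u \<in> {0<..<1}) (at_left (1::real))"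
        by (rule eventually_at_left_real) simp
      then show "eventually (\<lambda>u. ereal (poly G u) \<le> g u) (at_left 1)"
        by eventually_elim (use G(4) g_gr in auto)
    qed simp
    then show ?thesis using h t \<open>t\<^sup>2 = 1\<close> by (simp add: H)
  qed
  have dh: "(hr has_real_derivative deriv gr (t\<^sup>2) * (2 * t)) (at t)" if t: "t \<in> {-1<..<1}" "t \<noteq> 0" for t
  proof -
    have "t\<^sup>2 \<in> {0<..<1}" using t by (auto simp: abs_square_less_1)
    then have "(gr has_real_derivative deriv gr (t\<^sup>2)) (at (t\<^sup>2))"
      using g_diff[rule_format, of 0 "t\<^sup>2"] by (simp add: gr_def DERIV_deriv_iff_real_differentiable)
    then have "((\<lambda>t. gr (t\<^sup>2)) has_real_derivative deriv gr (t\<^sup>2) * (2 * t)) (at t)"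
      by (rule DERIV_chain2) (auto intro!: derivative_eq_intros)
    then show ?thesis
      by (rule has_field_derivative_transform_within_open[where S = "{-1<..<1}"])
         (use t h_in in \<open>auto simp: hr_def\<close>)
  qed
  define interp where "interp G \<longleftrightarrow> degree G \<le> 2 * k \<and> (\<forall>i\<in>I. ereal (poly G (x i)) = h (x i)) \<and>
     (\<forall>i\<in>I. x i \<notin> {-1, 0, 1} \<longrightarrow> poly (pderiv G) (x i) = deriv hr (x i))" for G
  have interior: "t \<in> {-1<..<1} \<and> t \<noteq> 0" if "t \<in> X" "t \<notin> {-1, 0, 1}" for t
    using that X(2) by force
  have interp_H: "interp H"
    unfolding interp_def
  proof (intro conjI ballI impI degH)
    fix i assume i: "i \<in> I"
    then have xi: "x i \<in> X" by (simp add: X_def)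
    then show "ereal (poly H (x i)) = h (x i)" using h_X by simp
    assume "x i \<notin> {-1, 0, 1}"
    then have int: "x i \<in> {-1<..<1} \<and> x i \<noteq> 0" using interior xi by blast
    then have "(x i)\<^sup>2 \<in> D" using xi by (auto simp: D_def U_def abs_square_less_1)
    then show "poly (pderiv H) (x i) = deriv hr (x i)"
      using dh[of "x i"] int by (simp add: dH G(3) DERIV_imp_deriv)
  qed
  have interp_unique: "G' = H" if G': "interp G'" for G'
  proof (rule ccontr)
    assume "G' \<noteq> H"
    then have nz: "G' - H \<noteq> 0" by simp
    have "card X + card (X - {-1, 0, 1}) \<le> degree (G' - H)"
    proof (rule hermite_zero_count[OF nz X(1)])
      have "poly G' (x i) = poly H (x i)" if "i \<in> I" for i
        using that interp_H G' by (metis ereal.inject interp_def)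
      then show "\<forall>t\<in>X. poly (G' - H) t = 0" by (auto simp: X_def)
      have "poly (pderiv G') (x i) = poly (pderiv H) (x i)" if "i \<in> I" "x i \<notin> {-1, 0, 1}" for i
        using that interp_H G' by (metis interp_def)
      then show "\<forall>t\<in>X - {-1, 0, 1}. poly (pderiv (G' - H)) t = 0" by (auto simp: X_def pderiv_diff)
    qed auto
    also have "\<dots> \<le> 2 * k" using degH G' by (intro degree_diff_le) (auto simp: interp_def)
    finally show False using cards(2) by simp
  qed
  have span: "\<exists>c. H = (\<Sum>i\<le>k. smult (c i) (gegenbauer n (2 * i)))"
    unfolding lessThan_Suc_atMost[symmetric]
    using gegenbauer_properties(1) gegenbauer_nonzero gegenbauer_even_poly n H_even degH
    by (intro even_poly_span) (auto simp: coeff_eq_0)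
  have H_feas: "H \<in> feasible_polys n k h"
    using span H_le by (simp add: feasible_polys_def)
  have feas_deg: "degree f \<le> 2 * k" if f: "f \<in> feasible_polys n k h" for f
  proof -
    obtain c where c: "f = (\<Sum>i\<le>k. smult (c i) (gegenbauer n (2 * i)))"
      using f by (auto simp: feasible_polys_def)
    show ?thesis
      unfolding c using gegenbauer_properties(1)[OF n]
      by (intro degree_sum_le) (auto intro!: order_trans[OF degree_smult_le])
  qed
  have feas_h: "ereal (poly f t) \<le> h t" if "f \<in> feasible_polys n k h" "t \<in> {-1..1}" for f t
    using that unfolding feasible_polys_def by blast
  have feas_le: "poly f (x i) \<le> poly H (x i)" if "f \<in> feasible_polys n k h" "i \<in> I" for f i
  proof -
    have "x i \<in> X" using that by (simp add: X_def)
    then have "ereal (poly f (x i)) \<le> ereal (poly H (x i))"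
      using feas_h[OF that(1) I(3)[OF that(2)]] by (simp only: h_X)
    then show ?thesis by simp
  qed
  have opt: "coeff_zero n f \<le> coeff_zero n H" if f: "f \<in> feasible_polys n k h" for f
    unfolding w(2)[OF feas_deg[OF f]] w(2)[OF degH]
    by (intro sum_mono mult_left_mono feas_le f less_imp_le[OF w(1)])
  have opt_unique: "f = H" if f: "f \<in> feasible_polys n k h" and eq: "coeff_zero n f = coeff_zero n H" for f
  proof -
    have fx: "poly f (x i) = poly H (x i)" if "i \<in> I" for i
    proof (rule ccontr)
      assume "poly f (x i) \<noteq> poly H (x i)"
      then have "poly f (x i) < poly H (x i)" using feas_le[OF f that] by simp
      then have "(\<Sum>i\<in>I. w i * poly f (x i)) < (\<Sum>i\<in>I. w i * poly H (x i))"
      proof (intro sum_strict_mono_ex1 ballI I(1))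
        show "w j * poly f (x j) \<le> w j * poly H (x j)" if "j \<in> I" for j
          by (intro mult_left_mono feas_le f that less_imp_le[OF w(1)])
        show "\<exists>j\<in>I. w j * poly f (x j) < w j * poly H (x j)"
          using w(1) that \<open>poly f (x i) < poly H (x i)\<close> by (intro bexI[of _ i] mult_strict_left_mono)
      qed
      then show False using eq w(2)[OF feas_deg[OF f]] w(2)[OF degH] by simp
    qed
    have "interp f"
      unfolding interp_def
    proof (intro conjI ballI impI feas_deg f)
      fix i assume i: "i \<in> I"
      then have xi: "x i \<in> X" by (simp add: X_def)
      then show hx: "ereal (poly f (x i)) = h (x i)" using h_X fx[OF i] by simp
      assume "x i \<notin> {-1, 0, 1}"
      then have int: "x i \<in> {-1<..<1}" "x i \<noteq> 0" using interior xi by blast+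
      let ?d = "\<lambda>t. hr t - poly f t"
      have le: "0 \<le> ?d t" if "t \<in> {-1<..<1}" for t
      proof -
        have "ereal (poly f t) \<le> h t" using feas_h[OF f] that by auto
        then show ?thesis using h_in[OF that] by (simp add: hr_def)
      qed
      have 0: "?d (x i) = 0" using hx by (metis diff_self hr_def real_of_ereal.simps(1))
      have der: "(?d has_real_derivative (deriv gr ((x i)\<^sup>2) * (2 * x i) - poly (pderiv f) (x i))) (at (x i))"
        by (intro DERIV_diff dh int poly_DERIV)
      have "deriv gr ((x i)\<^sup>2) * (2 * x i) - poly (pderiv f) (x i) = 0"
      proof (rule DERIV_local_min[OF der])
        show "0 < min (1 - x i) (x i + 1)" using int by auto
        show "\<forall>y. \<bar>x i - y\<bar> < min (1 - x i) (x i + 1) \<longrightarrow> ?d (x i) \<le> ?d y"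
        proof (intro allI impI)
          fix y assume "\<bar>x i - y\<bar> < min (1 - x i) (x i + 1)"
          then have "y \<in> {-1<..<1}" by (auto simp: abs_less_iff)
          from le[OF this] show "?d (x i) \<le> ?d y" unfolding 0 .
        qed
      qed
      then show "poly (pderiv f) (x i) = deriv hr (x i)"
        using DERIV_imp_deriv[OF dh[OF int]] by simp
    qed
    then show ?thesis by (rule interp_unique)
  qed
  have "is_arg_max (coeff_zero n) (\<lambda>f. f \<in> feasible_polys n k h) f \<longleftrightarrow> f = H" for f
    unfolding is_arg_max_def using H_feas opt opt_unique by (meson antisym not_less)
  moreover have "ereal (coeff_zero n H) = (\<Sum>i\<in>I. ereal (w i) * h (x i))"
  proof -
    have "(\<Sum>i\<in>I. ereal (w i) * h (x i)) = (\<Sum>i\<in>I. ereal (w i * poly H (x i)))"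
      by (intro sum.cong refl) (use h_X in \<open>simp add: X_def\<close>)
    then show ?thesis by (simp add: w(2)[OF degH])
  qed
  ultimately show ?thesis
    using interp_H interp_unique H_even H_feas
    unfolding interp_def hr_def by (intro exI[of _ H]) blast
qed

text \<open>Summing the minorant instead of \<open>h\<close> over the design gives, by \<open>design_mean\<close>, a value that does not
  depend on the point.\<close>

lemma min_potential_ge:
  fixes C :: "(real ^ 'n) set"
  assumes n: "n = CARD('n)" "n \<ge> 2" and C: "kk_design k C" "card C = N"
    and H: "even_poly H" "degree H \<le> 2 * k" "\<And>t. t \<in> {-1..1} \<Longrightarrow> ereal (poly H t) \<le> h t"
  shows "ereal (real N * coeff_zero n H) \<le> min_potential h C"
  unfolding min_potential_def
proof (rule INF_greatest)
  fix x :: "real ^ 'n" assume "x \<in> sphere 0 1"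
  then have x: "norm x = 1" by simp
  have "ereal (real N * coeff_zero n H) = (\<Sum>y\<in>C. ereal (poly H (x \<bullet> y)))"
    using design_mean[OF n C(1) H(1,2) x] C(2) by simp
  also have "\<dots> \<le> (\<Sum>y\<in>C. h (x \<bullet> y))"
  proof (rule sum_mono, rule H(3))
    fix y assume "y \<in> C"
    then have "norm y = 1" using C by (auto simp: kk_design_def spherical_code_def)
    then have "\<bar>x \<bullet> y\<bar> \<le> 1" using Cauchy_Schwarz_ineq2[of x y] x by simp
    then show "x \<bullet> y \<in> {-1..1}" by auto
  qed
  finally show "ereal (real N * coeff_zero n H) \<le> potential h x C" by (simp add: potential_def)
qed

text \<open>The whole conclusion for an abstract node set; the Gauss rule and the Gauss-Lobatto rule, with
  their interpolation conditions, are two instances.\<close>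

lemma lp_bound:
  fixes g h :: "real \<Rightarrow> ereal" and x w :: "nat \<Rightarrow> real" and C :: "(real ^ 'n) set"
  assumes n: "n = CARD('n)" "n \<ge> 2"
    and C: "kk_design k C" "card C = N"
    and h: "\<forall>t\<in>{-1..1}. h t = g (t\<^sup>2)"
    and g_fin: "\<forall>u\<in>{0..1}. g u \<noteq> -\<infinity>" "\<forall>u\<in>{0..<1}. g u \<noteq> \<infinity>"
    and g_cont: "continuous_on {0..<1} g"
    and g_lim: "(g \<longlongrightarrow> g 1) (at_left 1)"
    and g_diff: "\<forall>j\<le>k. \<forall>u\<in>{0<..<1}. (deriv ^^ j) (\<lambda>v. real_of_ereal (g v)) differentiable (at u)"
    and I: "finite I" "inj_on x I" "\<And>i. i \<in> I \<Longrightarrow> x i \<in> {-1..1}" "\<And>i. i \<in> I \<Longrightarrow> - x i \<in> x ` I"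
    and card: "card I = k + 1 + (if 1 \<in> x ` I then 1 else 0)"
    and w: "\<And>i. i \<in> I \<Longrightarrow> 0 < w i"
       "\<And>f. degree f \<le> 2 * k \<Longrightarrow> coeff_zero n f = (\<Sum>i\<in>I. w i * poly f (x i))"
    and g1: "1 \<in> x ` I \<Longrightarrow> g 1 \<noteq> \<infinity>"
    and sgn: "\<And>t. 1 \<notin> x ` I \<Longrightarrow> t \<in> {0<..<1} \<Longrightarrow> (deriv ^^ (k + 1)) (\<lambda>v. real_of_ereal (g v)) t \<ge> 0"
       "\<And>t. 1 \<in> x ` I \<Longrightarrow> t \<in> {0<..<1} \<Longrightarrow> (deriv ^^ (k + 1)) (\<lambda>v. real_of_ereal (g v)) t \<le> 0"
    and interp: "\<And>G. interp G \<longleftrightarrow> degree G \<le> 2 * k \<and> (\<forall>i\<in>I. ereal (poly G (x i)) = h (x i)) \<and>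
          (\<forall>i\<in>I. x i \<notin> {-1, 0, 1} \<longrightarrow> poly (pderiv G) (x i) = deriv (\<lambda>t. real_of_ereal (h t)) (x i))"
  shows "let bound = ereal (real N) * (\<Sum>i\<in>I. ereal (w i) * h (x i)) in
          maxmin_potential TYPE('n) h N \<ge> maxmin_potential_design TYPE('n) h N k \<and>
          maxmin_potential_design TYPE('n) h N k \<ge> min_potential h C \<and>
          min_potential h C \<ge> bound \<and>
          (SUP f\<in>feasible_polys n k h. ereal (real N * coeff_zero n f)) = bound \<and>
          (\<exists>H. (\<forall>G. interp G \<longleftrightarrow> G = H) \<and>
               H \<in> feasible_polys n k h \<and>
               (\<forall>f. is_arg_max (coeff_zero n) (\<lambda>f. f \<in> feasible_polys n k h) f \<longleftrightarrow> f = H) \<and>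
               ereal (real N * coeff_zero n H) = bound)"
proof -
  obtain H where H: "\<And>G. interp G \<longleftrightarrow> G = H" "even_poly H" "H \<in> feasible_polys n k h"
      "\<And>f. is_arg_max (coeff_zero n) (\<lambda>f. f \<in> feasible_polys n k h) f \<longleftrightarrow> f = H"
      "ereal (coeff_zero n H) = (\<Sum>i\<in>I. ereal (w i) * h (x i))"
    using lp_solution[OF n(2) h g_fin g_cont g_lim g_diff I card w g1 sgn] unfolding interp by blast
  define bound where "bound = ereal (real N) * (\<Sum>i\<in>I. ereal (w i) * h (x i))"
  have bound: "bound = ereal (real N * coeff_zero n H)" by (simp add: bound_def H(5)[symmetric])
  have le: "coeff_zero n f \<le> coeff_zero n H" if "f \<in> feasible_polys n k h" for f
    using H(4)[of H] that by (auto simp: is_arg_max_def not_less)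
  have 1: "(SUP f\<in>feasible_polys n k h. ereal (real N * coeff_zero n f)) = bound"
    unfolding bound
    by (intro antisym SUP_least SUP_upper2[OF H(3)]) (auto intro!: mult_left_mono le)
  have 2: "bound \<le> min_potential h C"
    unfolding bound using H(1)[of H] H(3)
    by (intro min_potential_ge[OF n C H(2)]) (auto simp: interp feasible_polys_def)
  have 3: "min_potential h C \<le> maxmin_potential_design TYPE('n) h N k"
    unfolding maxmin_potential_design_def using C by (intro SUP_upper) simp
  have 4: "maxmin_potential_design TYPE('n) h N k \<le> maxmin_potential TYPE('n) h N"
    unfolding maxmin_potential_design_def maxmin_potential_def
    by (intro SUP_subset_mono) (auto simp: kk_design_def)
  show ?thesis
    unfolding Let_def bound_def[symmetric]
    by (intro conjI exI[of _ H] allI 1 2 3 4 H(1,3,4) bound[symmetric])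
qed

section \<open>Gauss and Gauss-Lobatto quadrature\<close>

lemma poly_eq_prod_roots:
  fixes p :: "real poly"
  assumes "finite I" "inj_on x I" "degree p = card I" "\<And>i. i \<in> I \<Longrightarrow> poly p (x i) = 0"
  shows "p = smult (lead_coeff p) (\<Prod>i\<in>I. [:- x i, 1:])"
proof (rule poly_eqI_degree_lead_coeff[where n = "card I" and A = "x ` I"])
  let ?w = "\<Prod>i\<in>I. [:- x i, 1:]"
  have deg: "degree ?w = card I" by (subst degree_prod_sum_eq) auto
  have "lead_coeff ?w = 1" by (simp add: lead_coeff_prod)
  then show "coeff p (card I) = coeff (smult (lead_coeff p) ?w) (card I)" using deg assms(3) by simp
  show "degree (smult (lead_coeff p) ?w) \<le> card I" using deg by (metis degree_smult_le)
  show "poly p z = poly (smult (lead_coeff p) ?w) z" if "z \<in> x ` I" for z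
    using that assms by (auto simp: poly_prod)
qed (use assms in \<open>auto simp: card_image\<close>)

lemma gegenbauer_node_prod:
  assumes "n \<ge> 2"
  shows "(\<Prod>i\<in>{1..l}. [:- gegenbauer_zero n l i, 1:]) = smult (1 / lead_coeff (gegenbauer n l)) (gegenbauer n l)"
proof -
  note b = gegenbauer_zero_bij_betw(1)[OF assms, of l]
  have "gegenbauer n l = smult (lead_coeff (gegenbauer n l)) (\<Prod>i\<in>{1..l}. [:- gegenbauer_zero n l i, 1:])"
  proof (rule poly_eq_prod_roots)
    show "poly (gegenbauer n l) (gegenbauer_zero n l i) = 0" if "i \<in> {1..l}" for i
      using bij_betwE[OF b] that by auto
  qed (use b gegenbauer_properties(1)[OF assms] in \<open>auto simp: bij_betw_def\<close>)
  moreover have "lead_coeff (gegenbauer n l) \<noteq> 0" using gegenbauer_nonzero[OF assms] by simp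
  ultimately show ?thesis
    by (metis (no_types, lifting) smult_smult smult_1_left nonzero_eq_divide_eq)
qed

lemma alpha_nodes:
  assumes "n \<ge> 2"
  shows "inj_on (alpha n k) {1..k + 1}"
    and "i \<in> {1..k + 1} \<Longrightarrow> alpha n k i \<in> {-1<..<1}"
    and "i \<in> {1..k + 1} \<Longrightarrow> - alpha n k i \<in> alpha n k ` {1..k + 1}"
proof -
  have b: "bij_betw (alpha n k) {1..k + 1} {x. poly (gegenbauer n (k + 1)) x = 0}"
    using gegenbauer_zero_bij_betw(1)[OF assms, of "k + 1"] by (simp add: alpha_def[abs_def])
  show "inj_on (alpha n k) {1..k + 1}" using b by (rule bij_betw_imp_inj_on)
  have im: "alpha n k ` {1..k + 1} = {x. poly (gegenbauer n (k + 1)) x = 0}"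
    using b by (rule bij_betw_imp_surj_on)
  show "alpha n k i \<in> {-1<..<1}" if "i \<in> {1..k + 1}"
    using im that gegenbauer_zero_bij_betw(2)[OF assms, of "k + 1"] by blast
  have "alpha n k i \<in> {x. poly (gegenbauer n (k + 1)) x = 0}" if "i \<in> {1..k + 1}"
    using im that by blast
  then show "- alpha n k i \<in> alpha n k ` {1..k + 1}" if "i \<in> {1..k + 1}"
    using that unfolding im by (simp add: gegenbauer_root_uminus[OF assms])
qed

text \<open>The squares of the Lagrange polynomials witness that the weights are positive.\<close>

lemma gauss_quadrature:
  assumes "n \<ge> 2"
  shows "degree f \<le> 2 * k + 1 \<Longrightarrow> coeff_zero n f = (\<Sum>i=1..k + 1. rho n k i * poly f (alpha n k i))"
    and "i \<in> {1..k + 1} \<Longrightarrow> 0 < rho n k i"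
proof -
  interpret positive_functional "coeff_zero n" by (rule coeff_zero_positive_functional[OF assms])
  let ?I = "{1..k + 1}" and ?P = "gegenbauer n (k + 1)"
  note nodes = alpha_nodes[OF assms, where k = k]
  have orth: "coeff_zero n ((\<Prod>i\<in>?I. [:- alpha n k i, 1:]) * q) = 0" if "degree q + card ?I \<le> 2 * k + 1" for q
  proof -
    have "coeff_zero n (?P * q) = 0"
      using gegenbauer_properties(1,2)[OF assms, of "k + 1"] that by (simp add: orthogonal_def)
    then show ?thesis
      unfolding alpha_def gegenbauer_node_prod[OF assms] by (simp add: L_smult)
  qed
  show exact: "coeff_zero n f = (\<Sum>i=1..k + 1. rho n k i * poly f (alpha n k i))" if "degree f \<le> 2 * k + 1" for f
    unfolding rho_def by (rule quadrature_exact[OF _ nodes(1) orth that]) auto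
  show "0 < rho n k i" if i: "i \<in> ?I"
  proof -
    define l where "l = lagrange_fundamental ?I (alpha n k) i"
    have l: "degree l < card ?I" "\<And>j. j \<in> ?I \<Longrightarrow> poly l (alpha n k j) = (if i = j then 1 else 0)"
      using lagrange_fundamental_props[OF _ nodes(1) i] by (auto simp: l_def)
    show ?thesis
    proof (rule quadrature_weight_pos[where I = ?I and x = "alpha n k" and p = "l * l" and M = "2 * k + 1"])
      show "degree (l * l) \<le> 2 * k + 1" using degree_mult_le[of l l] l(1) by simp
    qed (use i l(2) exact in auto)
  qed
qed

lemma beta_nodes:
  assumes "n \<ge> 2"
  shows "inj_on (beta n k) {0..k + 1}"
    and "i \<in> {1..k} \<Longrightarrow> beta n k i \<in> {-1<..<1}"
    and "i \<in> {0..k + 1} \<Longrightarrow> - beta n k i \<in> beta n k ` {0..k + 1}"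
    and "beta n k 0 = -1" "beta n k (k + 1) = 1"
proof -
  have n2: "n + 2 \<ge> 2" by simp
  let ?Z = "{x. poly (gegenbauer (n + 2) k) x = 0}"
  note b = gegenbauer_zero_bij_betw[OF n2, of k]
  have eq: "beta n k i = gegenbauer_zero (n + 2) k i" if "i \<in> {1..k}" for i
    using that by (simp add: beta_def)
  show e: "beta n k 0 = -1" "beta n k (k + 1) = 1" by (simp_all add: beta_def)
  have b': "bij_betw (beta n k) {1..k} ?Z"
    using b(1) eq by (subst bij_betw_cong) auto
  have im: "beta n k ` {1..k} = ?Z" using b' by (rule bij_betw_imp_surj_on)
  show "beta n k i \<in> {-1<..<1}" if "i \<in> {1..k}" for i
    using im that b(2) by blast
  have split: "{0..k + 1} = insert 0 (insert (k + 1) {1..k})" by auto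
  have "(1::real) \<notin> ?Z" "(-1::real) \<notin> ?Z" using b(2) by auto
  then show "inj_on (beta n k) {0..k + 1}"
    unfolding split using bij_betw_imp_inj_on[OF b'] im e by (simp add: inj_on_insert)
  have "- beta n k i \<in> ?Z" if "i \<in> {1..k}" for i
    using im that by (metis (mono_tags, lifting) gegenbauer_root_uminus[OF n2] imageI mem_Collect_eq)
  then show "- beta n k i \<in> beta n k ` {0..k + 1}" if "i \<in> {0..k + 1}"
    using that unfolding split image_insert im by (auto simp: e simp del: One_nat_def)
qed

text \<open>The node polynomial is \<open>t\<^sup>2 - 1\<close> times the Gegenbauer polynomial of dimension \<open>n + 2\<close>, hence
  orthogonal to degrees below \<open>k\<close>. The weights are positive because of \<open>(1 - t) V\<^sup>2\<close> and
  \<open>(1 + t) V\<^sup>2\<close> at the end points, where \<open>V\<close> is the product over the interior nodes, and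
  \<open>(1 - t\<^sup>2) S\<^sup>2\<close> at an interior node, where \<open>S\<close> omits its factor.\<close>

lemma gauss_lobatto_quadrature:
  assumes n: "n \<ge> 2" and "k \<ge> 1"
  shows "degree f \<le> 2 * k + 1 \<Longrightarrow> coeff_zero n f = (\<Sum>i=0..k + 1. delta n k i * poly f (beta n k i))"
    and "i \<in> {0..k + 1} \<Longrightarrow> 0 < delta n k i"
proof -
  interpret positive_functional "coeff_zero n" by (rule coeff_zero_positive_functional[OF n])
  have n2: "n + 2 \<ge> 2" by simp
  interpret n2: positive_functional "coeff_zero (n + 2)" by (rule coeff_zero_positive_functional[OF n2])
  let ?I = "{0..k + 1}" and ?P = "gegenbauer (n + 2) k"
  define V where "V = (\<Prod>i\<in>{1..k}. [:- beta n k i, 1:])"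
  note nodes = beta_nodes[OF n, where k = k]
  have split: "?I = insert 0 (insert (k + 1) {1..k})" by auto
  have V_eq: "V = smult (1 / lead_coeff ?P) ?P"
    unfolding V_def gegenbauer_node_prod[OF n2, symmetric]
    by (intro prod.cong refl) (simp add: beta_def)
  have all: "(\<Prod>i\<in>?I. [:- beta n k i, 1:]) = smult (-1) ([:1, 0, -1:] * V)"
    unfolding split V_def using nodes(4,5) by (simp add: algebra_simps)
  have orth: "coeff_zero n ((\<Prod>i\<in>?I. [:- beta n k i, 1:]) * q) = 0" if "degree q + card ?I \<le> 2 * k + 1" for q
  proof -
    have "degree q < degree ?P" using that unfolding gegenbauer_properties(1)[OF n2] by simp
    then have "coeff_zero (n + 2) (?P * q) = 0"
      using gegenbauer_properties(2)[OF n2, of k] unfolding n2.orthogonal_def by blast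
    then have "coeff_zero n ([:1, 0, -1:] * (?P * q)) = 0"
      using gegenbauer_const_pos[OF n] gegenbauer_const_pos[OF n2]
      unfolding coeff_zero_add_2[OF n] by (simp only: mult_eq_0_iff divide_eq_0_iff less_irrefl) auto
    moreover have "(\<Prod>i\<in>?I. [:- beta n k i, 1:]) * q = smult (- 1 / lead_coeff ?P) ([:1, 0, -1:] * (?P * q))"
      unfolding all V_eq by (simp add: mult.assoc del: mult_pCons_left)
    ultimately show ?thesis by (simp only: L_smult)
  qed
  have exact: "coeff_zero n f = (\<Sum>i=0..k + 1. delta n k i * poly f (beta n k i))" if "degree f \<le> 2 * k + 1" for f
    unfolding delta_def by (rule quadrature_exact[OF _ nodes(1) orth that]) auto
  then show "degree f \<le> 2 * k + 1 \<Longrightarrow> coeff_zero n f = (\<Sum>i=0..k + 1. delta n k i * poly f (beta n k i))" .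
  have degV: "degree V = k" unfolding V_def by (subst degree_prod_sum_eq) auto
  have V0: "poly V (beta n k j) = 0" if "j \<in> {1..k}" for j
    using that by (auto simp: V_def poly_prod)
  have V_end: "poly V t \<noteq> 0" if "t = 1 \<or> t = -1" for t
    using nodes(2) that by (force simp: V_def poly_prod)
  show "0 < delta n k i" if i: "i \<in> ?I"
  proof -
    consider "i = 0" | "i = k + 1" | "i \<in> {1..k}" using i unfolding split by blast
    then show ?thesis
    proof cases
      case 1
      show ?thesis
      proof (rule quadrature_weight_pos[where I = ?I and x = "beta n k" and p = "[:1, -1:] * (V * V)" and M = "2 * k + 1"])
        have "V \<noteq> 0" using V_end by force
        then show "degree ([:1, -1:] * (V * V)) \<le> 2 * k + 1"
          by (subst degree_mult_eq) (auto simp: degree_mult_eq degV)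
        show "poly ([:1, -1:] * (V * V)) (beta n k j) = 0" if "j \<in> ?I" "j \<noteq> i" for j
        proof -
          have "j = k + 1 \<or> j \<in> {1..k}" using that 1 unfolding split by blast
          then show ?thesis using V0 nodes(5) by auto
        qed
        have "poly ([:1, -1:] * (V * V)) t = (1 - t) * (poly V t)\<^sup>2" for t
          by (simp add: power2_eq_square algebra_simps)
        then show "0 \<le> poly ([:1, -1:] * (V * V)) t" if "t \<in> {-1..1}" for t
          using that by simp
        show "0 < poly ([:1, -1:] * (V * V)) (beta n k i)"
          using V_end[of "-1"] nodes(4) 1 by (auto simp: zero_less_mult_iff linorder_neq_iff)
      qed (use i exact in auto)
    next
      case 2
      show ?thesis
      proof (rule quadrature_weight_pos[where I = ?I and x = "beta n k" and p = "[:1, 1:] * (V * V)" and M = "2 * k + 1"])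
        have "V \<noteq> 0" using V_end by force
        then show "degree ([:1, 1:] * (V * V)) \<le> 2 * k + 1"
          by (subst degree_mult_eq) (auto simp: degree_mult_eq degV)
        show "poly ([:1, 1:] * (V * V)) (beta n k j) = 0" if "j \<in> ?I" "j \<noteq> i" for j
        proof -
          have "j = 0 \<or> j \<in> {1..k}" using that 2 unfolding split by blast
          then show ?thesis using V0 nodes(4) by auto
        qed
        have "poly ([:1, 1:] * (V * V)) t = (1 + t) * (poly V t)\<^sup>2" for t
          by (simp add: power2_eq_square algebra_simps)
        then show "0 \<le> poly ([:1, 1:] * (V * V)) t" if "t \<in> {-1..1}" for t
          using that by simp
        show "0 < poly ([:1, 1:] * (V * V)) (beta n k i)"
          using V_end[of 1] nodes(5) 2 by (auto simp: zero_less_mult_iff linorder_neq_iff)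
      qed (use i exact in auto)
    next
      case 3
      define S where "S = (\<Prod>j\<in>{1..k} - {i}. [:- beta n k j, 1:])"
      have degS: "degree S = k - 1" unfolding S_def using 3 by (subst degree_prod_sum_eq) auto
      have S0: "poly S (beta n k j) = 0" if "j \<in> {1..k}" "j \<noteq> i" for j
        using that by (auto simp: S_def poly_prod)
      have Si: "poly S (beta n k i) \<noteq> 0"
        using inj_onD[OF nodes(1)] 3 by (fastforce simp: S_def poly_prod)
      show ?thesis
      proof (rule quadrature_weight_pos[where I = ?I and x = "beta n k" and p = "[:1, 0, -1:] * (S * S)" and M = "2 * k + 1"])
        have "S \<noteq> 0" using Si by force
        then show "degree ([:1, 0, -1:] * (S * S)) \<le> 2 * k + 1"
          using \<open>k \<ge> 1\<close> by (subst degree_mult_eq) (auto simp: degree_mult_eq degS)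
        show "poly ([:1, 0, -1:] * (S * S)) (beta n k j) = 0" if "j \<in> ?I" "j \<noteq> i" for j
        proof -
          have "j = 0 \<or> j = k + 1 \<or> j \<in> {1..k}" using that unfolding split by blast
          then show ?thesis using S0 nodes(4,5) that(2) by auto
        qed
        have ev: "poly ([:1, 0, -1:] * (S * S)) t = (1 - t\<^sup>2) * (poly S t)\<^sup>2" for t
          by (simp add: power2_eq_square algebra_simps)
        show "0 \<le> poly ([:1, 0, -1:] * (S * S)) t" if "t \<in> {-1..1}" for t
          unfolding ev using that by (auto intro!: mult_nonneg_nonneg simp: abs_square_le_1 abs_le_iff)
        show "0 < poly ([:1, 0, -1:] * (S * S)) (beta n k i)"
          unfolding ev using nodes(2)[OF 3] Si by (intro mult_pos_pos) (auto simp: abs_square_less_1)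
      qed (use i exact in auto)
    qed
  qed
qed

theorem theorem4p1:
  fixes n k N :: nat
    and g h :: "real \<Rightarrow> ereal"
    and C :: "(real ^ 'n) set"
  assumes "n = CARD('n)" and "n \<ge> 2" and "k \<ge> 1" and "N \<ge> 1"
    and "\<forall>t\<in>{-1..1}. h t = g (t\<^sup>2)"
    and "\<forall>u\<in>{0..1}. g u \<noteq> -\<infinity>" and "\<forall>u\<in>{0..<1}. g u \<noteq> \<infinity>"
    and "continuous_on {0..<1} g"
    and "(g \<longlongrightarrow> g 1) (at_left 1)"
    and "\<forall>j\<le>k. \<forall>u\<in>{0<..<1}. (deriv ^^ j) (\<lambda>v. real_of_ereal (g v)) differentiable (at u)"
    and "kk_design k C" and "card C = N"
  shows
    "((\<forall>u\<in>{0<..<1}. (deriv ^^ (k + 1)) (\<lambda>v. real_of_ereal (g v)) u \<ge> 0) \<longrightarrow>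
       (let bound = ereal (real N) * (\<Sum>i=1..k + 1. ereal (rho n k i) * h (alpha n k i)) in
          maxmin_potential TYPE('n) h N \<ge> maxmin_potential_design TYPE('n) h N k \<and>
          maxmin_potential_design TYPE('n) h N k \<ge> min_potential h C \<and>
          min_potential h C \<ge> bound \<and>
          (SUP f\<in>feasible_polys n k h. ereal (real N * coeff_zero n f)) = bound \<and>
          (\<exists>H. (\<forall>G. interpolates_alpha n k h G \<longleftrightarrow> G = H) \<and>
               H \<in> feasible_polys n k h \<and>
               (\<forall>f. is_arg_max (coeff_zero n) (\<lambda>f. f \<in> feasible_polys n k h) f \<longleftrightarrow> f = H) \<and>
               ereal (real N * coeff_zero n H) = bound))) \<and>
     ((\<forall>u\<in>{0<..<1}. (deriv ^^ (k + 1)) (\<lambda>v. real_of_ereal (g v)) u \<le> 0) \<longrightarrow>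
       (let bound = ereal (real N) * (\<Sum>i=0..k + 1. ereal (delta n k i) * h (beta n k i)) in
          maxmin_potential TYPE('n) h N \<ge> maxmin_potential_design TYPE('n) h N k \<and>
          maxmin_potential_design TYPE('n) h N k \<ge> min_potential h C \<and>
          min_potential h C \<ge> bound \<and>
          (SUP f\<in>feasible_polys n k h. ereal (real N * coeff_zero n f)) = bound \<and>
          (\<exists>H. (\<forall>G. interpolates_beta n k h G \<longleftrightarrow> G = H) \<and>
               H \<in> feasible_polys n k h \<and>
               (\<forall>f. is_arg_max (coeff_zero n) (\<lambda>f. f \<in> feasible_polys n k h) f \<longleftrightarrow> f = H) \<and>
               ereal (real N * coeff_zero n H) = bound)))"
proof (intro conjI impI)
  let ?gr = "\<lambda>v. real_of_ereal (g v)"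
  note common = lp_bound[OF assms(1,2,11,12,5-10)]
  assume sgn: "\<forall>u\<in>{0<..<1}. (deriv ^^ (k + 1)) ?gr u \<ge> 0"
  note nodes = alpha_nodes[OF assms(2), where k = k]
  have 1: "1 \<notin> alpha n k ` {1..k + 1}" using nodes(2) by (metis greaterThanLessThan_iff imageE less_irrefl)
  have int: "alpha n k i \<notin> {-1, 0, 1} \<longleftrightarrow> alpha n k i \<noteq> 0" if "i \<in> {1..k + 1}" for i
    using nodes(2)[OF that] by auto
  show "let bound = ereal (real N) * (\<Sum>i=1..k + 1. ereal (rho n k i) * h (alpha n k i)) in
          maxmin_potential TYPE('n) h N \<ge> maxmin_potential_design TYPE('n) h N k \<and>
          maxmin_potential_design TYPE('n) h N k \<ge> min_potential h C \<and>
          min_potential h C \<ge> bound \<and>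
          (SUP f\<in>feasible_polys n k h. ereal (real N * coeff_zero n f)) = bound \<and>
          (\<exists>H. (\<forall>G. interpolates_alpha n k h G \<longleftrightarrow> G = H) \<and>
               H \<in> feasible_polys n k h \<and>
               (\<forall>f. is_arg_max (coeff_zero n) (\<lambda>f. f \<in> feasible_polys n k h) f \<longleftrightarrow> f = H) \<and>
               ereal (real N * coeff_zero n H) = bound)"
  proof (rule common)
    show "alpha n k i \<in> {-1..1}" if "i \<in> {1..k + 1}" for i using nodes(2)[OF that] by auto
    show "coeff_zero n f = (\<Sum>i=1..k + 1. rho n k i * poly f (alpha n k i))" if "degree f \<le> 2 * k" for f
      using gauss_quadrature(1)[OF assms(2), of f k] that by simp
    show "interpolates_alpha n k h G \<longleftrightarrow> degree G \<le> 2 * k \<and>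
        (\<forall>i\<in>{1..k + 1}. ereal (poly G (alpha n k i)) = h (alpha n k i)) \<and>
        (\<forall>i\<in>{1..k + 1}. alpha n k i \<notin> {-1, 0, 1} \<longrightarrow>
          poly (pderiv G) (alpha n k i) = deriv (\<lambda>t. real_of_ereal (h t)) (alpha n k i))" for G
      unfolding interpolates_alpha_def using int by blast
  qed (use 1 sgn nodes gauss_quadrature(2)[OF assms(2)] in \<open>auto simp del: funpow.simps\<close>)
next
  let ?gr = "\<lambda>v. real_of_ereal (g v)"
  note common = lp_bound[OF assms(1,2,11,12,5-10)]
  assume sgn: "\<forall>u\<in>{0<..<1}. (deriv ^^ (k + 1)) ?gr u \<le> 0"
  note nodes = beta_nodes[OF assms(2), where k = k]
  have 1: "1 \<in> beta n k ` {0..k + 1}" using nodes(5) by (metis atLeastAtMost_iff imageI le0 order_refl)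
  have split: "{0..k + 1} = insert 0 (insert (k + 1) {1..k})" by auto
  \<comment> \<open>a polynomial bound for \<open>g\<close> to the left of \<open>1\<close> passes to the limit\<close>
  have g1: "g 1 \<noteq> \<infinity>"
  proof -
    obtain G where G: "\<And>u. u \<in> {1/2<..<1} \<Longrightarrow> ?gr u \<le> poly G u"
      using bounded_above_by_poly_near_1[of k ?gr] assms(10) sgn by blast
    have "g 1 \<le> ereal (poly G 1)"
    proof (rule tendsto_le[OF _ _ assms(9)])
      show "((\<lambda>u. ereal (poly G u)) \<longlongrightarrow> ereal (poly G 1)) (at_left 1)"
        by (intro tendsto_intros)
      have "eventually (\<lambda>u. u \<in> {1/2<..<1}) (at_left (1::real))"
        by (rule eventually_at_left_real) simp
      then show "eventually (\<lambda>u. g u \<le> ereal (poly G u)) (at_left 1)"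
      proof eventually_elim
        case (elim u)
        then have "g u \<noteq> \<infinity>" "g u \<noteq> -\<infinity>" using assms(6,7) by auto
        then show ?case using G[OF elim] by (cases "g u") auto
      qed
    qed simp
    then show ?thesis by auto
  qed
  show "let bound = ereal (real N) * (\<Sum>i=0..k + 1. ereal (delta n k i) * h (beta n k i)) in
          maxmin_potential TYPE('n) h N \<ge> maxmin_potential_design TYPE('n) h N k \<and>
          maxmin_potential_design TYPE('n) h N k \<ge> min_potential h C \<and>
          min_potential h C \<ge> bound \<and>
          (SUP f\<in>feasible_polys n k h. ereal (real N * coeff_zero n f)) = bound \<and>
          (\<exists>H. (\<forall>G. interpolates_beta n k h G \<longleftrightarrow> G = H) \<and>
               H \<in> feasible_polys n k h \<and>
               (\<forall>f. is_arg_max (coeff_zero n) (\<lambda>f. f \<in> feasible_polys n k h) f \<longleftrightarrow> f = H) \<and>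
               ereal (real N * coeff_zero n H) = bound)"
  proof (rule common)
    show "beta n k i \<in> {-1..1}" if "i \<in> {0..k + 1}" for i
    proof -
      have "i = 0 \<or> i = k + 1 \<or> i \<in> {1..k}" using that unfolding split by blast
      then show ?thesis using nodes(2)[of i] nodes(4,5) by auto
    qed
    show "coeff_zero n f = (\<Sum>i=0..k + 1. delta n k i * poly f (beta n k i))" if "degree f \<le> 2 * k" for f
      using gauss_lobatto_quadrature(1)[OF assms(2,3), of f] that by simp
    have int: "beta n k i \<notin> {-1, 0, 1} \<longleftrightarrow> beta n k i \<noteq> 0" if "i \<in> {1..k}" for i
      using nodes(2)[OF that] by auto
    have "(\<forall>i\<in>{0..k + 1}. beta n k i \<notin> {-1, 0, 1} \<longrightarrow> Q i) \<longleftrightarrow> (\<forall>i\<in>{1..k}. beta n k i \<noteq> 0 \<longrightarrow> Q i)" for Q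
      unfolding split using int nodes(4,5) by (simp only: ball_simps) blast
    then show "interpolates_beta n k h G \<longleftrightarrow> degree G \<le> 2 * k \<and>
        (\<forall>i\<in>{0..k + 1}. ereal (poly G (beta n k i)) = h (beta n k i)) \<and>
        (\<forall>i\<in>{0..k + 1}. beta n k i \<notin> {-1, 0, 1} \<longrightarrow>
          poly (pderiv G) (beta n k i) = deriv (\<lambda>t. real_of_ereal (h t)) (beta n k i))" for G
      unfolding interpolates_beta_def by presburger
  qed (use 1 g1 sgn nodes gauss_lobatto_quadrature(2)[OF assms(2,3)] in \<open>auto simp del: funpow.simps\<close>)
qed

end
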